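(* Let $b_{-2}>0$ be the constant such that the number of positive integers $n'\le n$ expressible as $x^2-2y^2$ with $x,y\in\mathbb{Z}$ is asymptotic to $b_{-2}\,n/\sqrt{\log n}$ as $n\to\infty$. For real $r>1$, let $F(r)$ be the number of integers $k$ with $|k|\le r^2$ such that the curve $x^2-2y^2=k$ contains a prime of $\mathbb{Z}[\sqrt{2}]$, and let $G(r)$ be the number of nonzero integers $k$ with $|k|\le r^2$ such that $k=a^2-2b^2$ for some $a,b\in\mathbb{Z}$. Then $$\frac{F(r)}{G(r)}\sim \frac{1}{2b_{-2}\sqrt{2\log r}}\quad (r\to\infty),$$ i.e., the probability that an element of $\mathbb{Z}[\sqrt{2}]$ in the region $|x^2-2y^2|\le r^2$ lies in a family of primes is asymptotic to $\frac{1}{2b_{-2}\sqrt{2\log r}}$.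
   Context: $\mathbb{Z}[\sqrt{2}]=\{a+b\sqrt{2} : a,b\in\mathbb{Z}\}$, identified with lattice points $(a,b)$, is a unique factorization domain with norm $N(a+b\sqrt{2})=a^2-2b^2$; a prime is a nonzero non-unit element divisible only by units (elements of norm $\pm1$) and its associates. A family is the set of elements of $\mathbb{Z}[\sqrt{2}]$ lying on one curve $x^2-2y^2=k$; the "probability" is the ratio of the number of families containing primes to the number of all (nonempty) families with $|k|\le r^2$. The existence of $b_{-2}$ is a known theorem (Landau/Bernays). $\log$ is the natural logarithm and $f\sim g$ means $f/g\to1$. *)

theory Defs
  imports Complex_Main "HOL-Library.Landau_Symbols" "HOL-Computational_Algebra.Primes"
begin

text \<open>
  The ring \<open>\<int>[\<surd>2]\<close>, its elements \<open>a + b\<surd>2\<close> being identified with the lattice points \<open>(a, b)\<close>.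
  The embedding \<open>real_of_zsqrt2\<close> below confirms that this is the intended subring of the reals.
\<close>

datatype zsqrt2 = ZSqrt2 (rat_part: int) (sqrt_part: int)

instantiation zsqrt2 :: comm_ring_1
begin

definition "0 = ZSqrt2 0 0"
definition "1 = ZSqrt2 1 0"
definition "z + w = ZSqrt2 (rat_part z + rat_part w) (sqrt_part z + sqrt_part w)"
definition "- z = ZSqrt2 (- rat_part z) (- sqrt_part z)"
definition "z - w = ZSqrt2 (rat_part z - rat_part w) (sqrt_part z - sqrt_part w)"
definition "z * w = ZSqrt2 (rat_part z * rat_part w + 2 * (sqrt_part z * sqrt_part w))
                           (rat_part z * sqrt_part w + sqrt_part z * rat_part w)"

instance
  by standard
    (simp_all add: zero_zsqrt2_def one_zsqrt2_def plus_zsqrt2_def uminus_zsqrt2_def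
      minus_zsqrt2_def times_zsqrt2_def algebra_simps)

end

definition real_of_zsqrt2 :: "zsqrt2 \<Rightarrow> real" where
  "real_of_zsqrt2 z = of_int (rat_part z) + of_int (sqrt_part z) * sqrt 2"

lemma range_real_of_zsqrt2:
  "range real_of_zsqrt2 = {of_int a + of_int b * sqrt 2 | a b :: int. True}"
proof -
  have "of_int a + of_int b * sqrt 2 = real_of_zsqrt2 (ZSqrt2 a b)" for a b
    by (simp add: real_of_zsqrt2_def)
  then have "of_int a + of_int b * sqrt 2 \<in> range real_of_zsqrt2" for a b
    by (metis rangeI)
  moreover have "\<exists>a b. real_of_zsqrt2 z = of_int a + of_int b * sqrt 2" for z
    by (auto simp: real_of_zsqrt2_def)
  ultimately show ?thesis by blast
qed

lemma real_of_zsqrt2_hom: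
  "real_of_zsqrt2 0 = 0"
  "real_of_zsqrt2 1 = 1"
  "real_of_zsqrt2 (z + w) = real_of_zsqrt2 z + real_of_zsqrt2 w"
  "real_of_zsqrt2 (z * w) = real_of_zsqrt2 z * real_of_zsqrt2 w"
  by (simp_all add: real_of_zsqrt2_def zero_zsqrt2_def one_zsqrt2_def plus_zsqrt2_def
      times_zsqrt2_def algebra_simps)

lemma inj_real_of_zsqrt2: "inj real_of_zsqrt2"
proof (rule injI)
  fix z w assume eq: "real_of_zsqrt2 z = real_of_zsqrt2 w"
  define a where "a = rat_part z - rat_part w"
  define b where "b = sqrt_part w - sqrt_part z"
  have "real_of_int a = of_int b * sqrt 2"
    using eq by (simp add: real_of_zsqrt2_def a_def b_def algebra_simps)
  then have "(real_of_int a)\<^sup>2 = 2 * (of_int b)\<^sup>2"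
    by (simp add: power_mult_distrib)
  then have ab: "a\<^sup>2 = 2 * b\<^sup>2"
    by (metis of_int_eq_iff of_int_mult of_int_numeral of_int_power)
  have "b = 0"
  proof (rule ccontr)
    assume "b \<noteq> 0"
    with ab have "a \<noteq> 0" by auto
    have "prime (2 :: int)" by simp
    then have "multiplicity 2 (a\<^sup>2) = 2 * multiplicity 2 a"
      and "multiplicity 2 (2 * b\<^sup>2) = 1 + 2 * multiplicity 2 b"
      using \<open>a \<noteq> 0\<close> \<open>b \<noteq> 0\<close>
      by (simp_all add: prime_elem_multiplicity_mult_distrib prime_elem_multiplicity_power_distrib)
    then have "2 * multiplicity 2 a = 1 + 2 * multiplicity 2 b"
      using ab by simp
    then show False by presburger
  qed
  with ab have "a = 0" by simp
  with \<open>b = 0\<close> show "z = w" by (simp add: a_def b_def zsqrt2.expand)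
qed

definition zsqrt2_norm :: "zsqrt2 \<Rightarrow> int" where
  "zsqrt2_norm z = (rat_part z)\<^sup>2 - 2 * (sqrt_part z)\<^sup>2"

lemma zsqrt2_norm_mult: "zsqrt2_norm (z * w) = zsqrt2_norm z * zsqrt2_norm w"
  by (simp add: zsqrt2_norm_def times_zsqrt2_def power2_eq_square algebra_simps)

lemma zsqrt2_norm_1: "zsqrt2_norm 1 = 1"
  by (simp add: zsqrt2_norm_def one_zsqrt2_def)

lemma zsqrt2_unit_iff_norm: "z dvd 1 \<longleftrightarrow> zsqrt2_norm z = 1 \<or> zsqrt2_norm z = - 1"
proof
  assume "z dvd 1"
  then obtain w where "1 = z * w" by (elim dvdE)
  then have "zsqrt2_norm z * zsqrt2_norm w = 1"
    by (metis zsqrt2_norm_mult zsqrt2_norm_1)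
  then show "zsqrt2_norm z = 1 \<or> zsqrt2_norm z = - 1"
    by (auto simp: zmult_eq_1_iff)
next
  assume *: "zsqrt2_norm z = 1 \<or> zsqrt2_norm z = - 1"
  define n where "n = zsqrt2_norm z"
  have "n * n = 1" using * by (auto simp: n_def)
  have "z * ZSqrt2 (n * rat_part z) (- n * sqrt_part z) = ZSqrt2 (n * zsqrt2_norm z) 0"
    by (simp add: times_zsqrt2_def zsqrt2_norm_def power2_eq_square algebra_simps)
  also have "\<dots> = 1"
    using \<open>n * n = 1\<close> by (simp add: n_def one_zsqrt2_def)
  finally show "z dvd 1" by (metis dvd_triv_left)
qed

definition zsqrt2_associated :: "zsqrt2 \<Rightarrow> zsqrt2 \<Rightarrow> bool" where
  "zsqrt2_associated z w \<longleftrightarrow> (\<exists>u. u dvd 1 \<and> w = u * z)"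

definition zsqrt2_prime :: "zsqrt2 \<Rightarrow> bool" where
  "zsqrt2_prime p \<longleftrightarrow> p \<noteq> 0 \<and> \<not> p dvd 1 \<and>
     (\<forall>d. d dvd p \<longrightarrow> d dvd 1 \<or> zsqrt2_associated p d)"

definition zsqrt2_family :: "int \<Rightarrow> zsqrt2 set" where
  "zsqrt2_family k = {z. (rat_part z)\<^sup>2 - 2 * (sqrt_part z)\<^sup>2 = k}"

definition num_prime_families :: "real \<Rightarrow> nat" where
  "num_prime_families r =
     card {k :: int. \<bar>of_int k\<bar> \<le> r\<^sup>2 \<and> (\<exists>p \<in> zsqrt2_family k. zsqrt2_prime p)}"

definition num_families :: "real \<Rightarrow> nat" where
  "num_families r =
     card {k :: int. k \<noteq> 0 \<and> \<bar>of_int k\<bar> \<le> r\<^sup>2 \<and> (\<exists>a b :: int. k = a\<^sup>2 - 2 * b\<^sup>2)}"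

definition num_represented :: "nat \<Rightarrow> nat" where
  "num_represented n =
     card {m :: nat. 0 < m \<and> m \<le> n \<and> (\<exists>x y :: int. int m = x\<^sup>2 - 2 * y\<^sup>2)}"

end

theory Submission
  imports Defs "HOL-Complex_Analysis.Complex_Analysis" "HOL-Number_Theory.Number_Theory"
    "HOL-Library.Discrete_Functions" "HOL-Real_Asymp.Real_Asymp"
begin

text \<open>
  Up to sign, the norm of a prime of \<open>\<int>[\<surd>2]\<close> is \<open>2\<close>, a rational prime \<open>p \<equiv> \<plusminus>1 (mod 8)\<close>, or the square
  of a rational prime; since \<open>1 + \<surd>2\<close> has norm \<open>-1\<close>, both signs occur. Hence \<open>F(r)\<close> is twice the
  number of primes \<open>p \<equiv> \<plusminus>1 (mod 8)\<close> up to \<open>r\<^sup>2\<close>, with an error \<open>O(r)\<close>, and \<open>G(r)\<close> is twice the number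
  of represented integers up to \<open>r\<^sup>2\<close>. It remains to show that half of all primes, in the sense of
  the prime number theorem, are \<open>\<plusminus>1\<close> modulo \<open>8\<close>.

  This is the prime ideal theorem for \<open>\<rat>(\<surd>2)\<close>. Let \<open>\<chi>\<close> be the even primitive character modulo \<open>8\<close> and
  \<open>\<zeta>\<^sub>K(s) = \<zeta>(s) L(s, \<chi>)\<close>. The function \<open>D(s) = (s - 1) \<zeta>\<^sub>K(s)\<close> is holomorphic for \<open>Re s > 0\<close>, and
  \<open>\<zeta>\<^sub>K\<close> is a constant times the exponential of a Dirichlet series with coefficients
  \<open>\<Lambda>(n) (1 + \<chi>(n)) / ln n \<ge> 0\<close>, so the 3-4-1 inequality excludes zeros of \<open>D\<close> on \<open>Re s = 1\<close>. Newman's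
  contour argument then gives the convergence of \<open>\<Sum> (\<psi>\<^sub>K(n)/n - 1)/n\<close>, where
  \<open>\<psi>\<^sub>K(n) = \<Sum>\<^bsub>k\<le>n\<^esub> \<Lambda>(k) (1 + \<chi>(k))\<close>, and monotonicity of \<open>\<psi>\<^sub>K\<close> yields \<open>\<psi>\<^sub>K(n) ~ n\<close>.
\<close>

section \<open>Newman's Tauberian theorem\<close>

text \<open>No zero-free region is at hand, only nonvanishing on the line Re s = 1; Newman's method
  asks for no more than holomorphy in some neighbourhood of the closed half-plane. It also asks for
  bounded coefficients, so it is applied to \<open>psiK n / n - 1\<close>, bounded by Chebyshev's
  estimate, and not to the von Mangoldt weights. Treating both residue classes at once keeps the
  weights 1 + \<chi> nonnegative, so that a single 3-4-1 argument serves \<zeta> and L together at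
  all points of the line except 1, where L(1) is seen directly to be positive. Euler products and
  branches of the logarithm are avoided: the convolution identity between f ln, f and f \<Lambda>
  shows that two functions have the same logarithmic derivative, hence differ by a constant factor.
  On the arithmetic side everything rests on elements of norm -p, found by Thue's argument; they
  serve to construct primes as well as to classify them.\<close>

lemma powr_diff_mvt:
  fixes a x y :: real
  assumes "0 < x" "x < y"
  obtains z where "x < z" "z < y" "y powr a - x powr a = (y - x) * (a * z powr (a - 1))"
proof -
  have "\<exists>z>x. z < y \<and> y powr a - x powr a = (y - x) * (a * z powr (a - 1))"
    using assms by (intro MVT2) (auto intro!: DERIV_fun_powr derivative_eq_intros)
  then show ?thesis using that by blast
qed

text \<open>Comparison with the integral of t^(-x-1), written as a difference so that tails of
  Dirichlet series telescope. The factor 1/x is the one that Newman's kernel cancels.\<close>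

lemma powr_decreasing_le_diff:
  fixes x :: real
  assumes "x > 0" "n > 0"
  shows "real (Suc n) powr (-x - 1) \<le> (real n powr -x - real (Suc n) powr -x) / x"
proof -
  obtain z where z: "real n < z" "z < real (Suc n)"
    "real (Suc n) powr -x - real n powr -x = (real (Suc n) - real n) * (- x * z powr (- x - 1))"
    using powr_diff_mvt[of "real n" "real (Suc n)" "-x"] assms by auto
  have "real (Suc n) powr (-x - 1) \<le> z powr (-x - 1)"
    using z assms by (intro powr_mono2') auto
  then have "x * real (Suc n) powr (-x - 1) \<le> x * z powr (-x - 1)"
    using assms by (intro mult_left_mono) auto
  also have "\<dots> = real n powr -x - real (Suc n) powr -x" using z by simp
  finally show ?thesis using assms by (simp add: pos_le_divide_eq mult.commute)
qed

text \<open>Again an integral comparison. For x \<le> 1 the integrand t^(x-1) decreases and the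
  first summand suffices; for x > 1 it increases, the comparison shifts by one index, and the last
  term is left over.\<close>

lemma sum_powr_le:
  fixes x :: real
  assumes "x > 0" "N > 0"
  shows "(\<Sum>n=1..N. real n powr (x - 1)) \<le> real N powr x / x + real N powr (x - 1)"
proof (cases "x \<le> 1")
  case True
  have "(\<Sum>n=1..N. real n powr (x - 1)) \<le> real N powr x / x"
    using \<open>N > 0\<close>
  proof (induction N rule: nat_induct_non_zero)
    case 1
    then show ?case using True assms by simp
  next
    case (Suc n)
    obtain z where z: "real n < z" "z < real (Suc n)"
      "real (Suc n) powr x - real n powr x = (real (Suc n) - real n) * (x * z powr (x - 1))"
      using powr_diff_mvt[of "real n" "real (Suc n)" x] Suc by auto
    have "real (Suc n) powr (x - 1) \<le> z powr (x - 1)"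
      using z Suc True by (intro powr_mono2') auto
    also have "\<dots> = (real (Suc n) powr x - real n powr x) / x"
      using z assms by (simp add: field_simps)
    finally show ?case using Suc.IH by (simp add: diff_divide_distrib)
  qed
  then show ?thesis by (simp add: add_increasing2)
next
  case False
  show ?thesis using \<open>N > 0\<close>
  proof (induction N rule: nat_induct_non_zero)
    case 1
    then show ?case using assms by simp
  next
    case (Suc n)
    obtain z where z: "real n < z" "z < real (Suc n)"
      "real (Suc n) powr x - real n powr x = (real (Suc n) - real n) * (x * z powr (x - 1))"
      using powr_diff_mvt[of "real n" "real (Suc n)" x] Suc by auto
    have "real n powr (x - 1) \<le> z powr (x - 1)"
      using z Suc False by (intro powr_mono2) auto
    also have "\<dots> = (real (Suc n) powr x - real n powr x) / x"
      using z assms by (simp add: field_simps)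
    finally show ?case using Suc.IH by (simp add: diff_divide_distrib)
  qed
qed

lemma norm_nat_powr: "norm (of_nat n powr s :: complex) = real n powr Re s"
  by (cases "n = 0") (auto simp: norm_powr_real_powr)

lemma dirichlet_series_tail_bound:
  fixes a :: "nat \<Rightarrow> complex"
  assumes a: "\<And>n. norm (a n) \<le> C" and s: "Re s > 1" and N: "N > 0"
    and sums: "(\<lambda>n. a n * of_nat n powr -s) sums g"
  shows "norm (g - (\<Sum>n\<le>N. a n * of_nat n powr -s)) \<le> C * real N powr (1 - Re s) / (Re s - 1)"
proof -
  define x where "x = Re s - 1"
  have x: "x > 0" using s by (simp add: x_def)
  have C: "C \<ge> 0" using a[of 0] norm_ge_zero order_trans by blast
  have "(\<lambda>k. a (k + Suc N) * of_nat (k + Suc N) powr -s) sums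
          (g - (\<Sum>n\<le>N. a n * of_nat n powr -s))"
    using sums sums_iff_shift[of "\<lambda>n. a n * of_nat n powr -s" "Suc N"]
    by (simp only: lessThan_Suc_atMost diff_add_cancel)
  moreover have "(\<lambda>k. C * ((real (k + N) powr -x - real (Suc k + N) powr -x) / x)) sums
                   (C * ((real (0 + N) powr -x - 0) / x))"
  proof (intro sums_mult sums_divide telescope_sums')
    have "filterlim (\<lambda>k. real (k + N)) at_top at_top"
      by (rule filterlim_compose[OF filterlim_real_sequentially]) (simp add: filterlim_add_const_nat_at_top)
    then show "(\<lambda>k. real (k + N) powr -x) \<longlonglongrightarrow> 0"
      using x by (intro tendsto_neg_powr) auto
  qed
  moreover have "norm (a (k + Suc N) * of_nat (k + Suc N) powr -s)
      \<le> C * ((real (k + N) powr -x - real (Suc k + N) powr -x) / x)" for k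
  proof -
    have "norm (a (k + Suc N) * of_nat (k + Suc N) powr -s)
            \<le> C * real (k + Suc N) powr (-x - 1)"
      using a C by (simp only: norm_mult norm_nat_powr) (auto intro!: mult_mono simp: x_def)
    also have "\<dots> \<le> C * ((real (k + N) powr -x - real (Suc k + N) powr -x) / x)"
      using powr_decreasing_le_diff[OF x, of "k + N"] N C by (intro mult_left_mono) auto
    finally show ?thesis .
  qed
  ultimately have "norm (g - (\<Sum>n\<le>N. a n * of_nat n powr -s)) \<le> C * ((real (0 + N) powr -x - 0) / x)"
    by (rule norm_sums_le)
  then show ?thesis by (simp add: x_def)
qed

lemma dirichlet_partial_sum_bound:
  fixes a :: "nat \<Rightarrow> complex"
  assumes a: "\<And>n. norm (a n) \<le> C" and s: "Re s < 1" and N: "N > 0"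
  shows "norm (\<Sum>n\<le>N. a n * of_nat n powr -s) \<le> C * (real N powr (1 - Re s) / (1 - Re s) + real N powr (- Re s))"
proof -
  have C: "C \<ge> 0" using a[of 0] norm_ge_zero order_trans by blast
  have "norm (\<Sum>n\<le>N. a n * of_nat n powr -s) \<le> (\<Sum>n\<le>N. C * real n powr (- Re s))"
    using a C by (intro sum_norm_le) (auto simp: norm_mult norm_nat_powr intro!: mult_right_mono)
  also have "\<dots> = C * (\<Sum>n=1..N. real n powr ((1 - Re s) - 1))"
    unfolding sum_distrib_left[symmetric]
    by (intro arg_cong[where f = "(*) C"] sum.mono_neutral_cong_right) (auto simp: not_less_eq_eq)
  also have "\<dots> \<le> C * (real N powr (1 - Re s) / (1 - Re s) + real N powr ((1 - Re s) - 1))"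
    using s N C by (intro mult_left_mono sum_powr_le) auto
  finally show ?thesis by simp
qed

section \<open>Kernel, Cauchy formula and decay estimate for the contour\<close>

text \<open>On the circle z times its conjugate is R^2, so the kernel collapses to 2 Re z / R^2. Its
  zeros at \<plusminus>iR compensate the growth 1/|Re z| of the bounds for tails and for partial
  sums.\<close>

lemma norm_Newman_kernel:
  assumes "norm z = R" "R > 0"
  shows "norm ((1 + z\<^sup>2 / of_real R ^ 2) / z) = 2 * \<bar>Re z\<bar> / R\<^sup>2"
proof -
  have z: "z \<noteq> 0" using assms by auto
  have "z * cnj z = of_real R ^ 2"
    using assms complex_norm_square[of z] by simp
  then have "(1 + z\<^sup>2 / of_real R ^ 2) / z = (cnj z + z) / of_real R ^ 2"
    using z assms by (simp add: field_simps power2_eq_square)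
  also have "cnj z + z = of_real (2 * Re z)"
    by (simp add: complex_add_cnj add.commute)
  finally show ?thesis using assms
    by (simp add: norm_divide norm_power norm_mult)
qed

text \<open>The path avoids the cut of the principal logarithm, whose imaginary part moves from
  -\<pi>/2 to \<pi>/2.\<close>

lemma has_contour_integral_inverse_right:
  assumes "valid_path g" "pathstart g = - \<i> * of_real R" "pathfinish g = \<i> * of_real R" "R > 0"
    "path_image g \<subseteq> - \<real>\<^sub>\<le>\<^sub>0"
  shows "((\<lambda>z. 1 / z) has_contour_integral (\<i> * of_real pi)) g"
proof -
  have d: "(Ln has_field_derivative 1 / z) (at z within - \<real>\<^sub>\<le>\<^sub>0)" if "z \<in> - \<real>\<^sub>\<le>\<^sub>0" for z
    using that by (auto intro!: derivative_eq_intros simp: inverse_eq_divide)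
  have "((\<lambda>z. 1 / z) has_contour_integral (Ln (pathfinish g) - Ln (pathstart g))) g"
    by (rule contour_integral_primitive[OF d]) (use assms in auto)
  moreover have "Ln (\<i> * of_real R) = of_real (ln R) + \<i> * of_real (pi / 2)"
    using assms Ln_times_of_real[of R "\<i>"] by (simp add: mult.commute Ln_of_real)
  moreover have "Ln (- \<i> * of_real R) = of_real (ln R) - \<i> * of_real (pi / 2)"
    using assms Ln_times_of_real[of R "-\<i>"] by (simp add: mult.commute Ln_of_real)
  ultimately show ?thesis using assms by simp
qed

text \<open>The branch \<open>Ln (- z)\<close> is cut along the positive axis, so semicircles and
  polygons on the left are covered alike.\<close>

lemma has_contour_integral_inverse_left:
  assumes "valid_path g" "pathstart g = \<i> * of_real R" "pathfinish g = - \<i> * of_real R" "R > 0"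
    "path_image g \<subseteq> - \<real>\<^sub>\<ge>\<^sub>0"
  shows "((\<lambda>z. 1 / z) has_contour_integral (\<i> * of_real pi)) g"
proof -
  have d: "((\<lambda>z. Ln (- z)) has_field_derivative 1 / z) (at z within - \<real>\<^sub>\<ge>\<^sub>0)" if "z \<in> - \<real>\<^sub>\<ge>\<^sub>0" for z
  proof -
    have "- z \<notin> \<real>\<^sub>\<le>\<^sub>0" using that by (auto simp: complex_nonpos_Reals_iff complex_nonneg_Reals_iff)
    then show ?thesis by (auto intro!: derivative_eq_intros simp: inverse_eq_divide)
  qed
  have "((\<lambda>z. 1 / z) has_contour_integral (Ln (- pathfinish g) - Ln (- pathstart g))) g"
    by (rule contour_integral_primitive[OF d]) (use assms in auto)
  moreover have "Ln (\<i> * of_real R) = of_real (ln R) + \<i> * of_real (pi / 2)"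
    using assms Ln_times_of_real[of R "\<i>"] by (simp add: mult.commute Ln_of_real)
  moreover have "Ln (- \<i> * of_real R) = of_real (ln R) - \<i> * of_real (pi / 2)"
    using assms Ln_times_of_real[of R "-\<i>"] by (simp add: mult.commute Ln_of_real)
  ultimately show ?thesis using assms by simp
qed

text \<open>The two half integrals of 1/z add up to 2\<pi>i, so the loop has winding number 1 about
  0 whatever its halves look like. One right half can thus be closed by two different left halves: a
  polygon in the domain of g, and a semicircle for the entire partial sums.\<close>

lemma Cauchy_formula_right_left:
  assumes A: "valid_path A" "pathstart A = - \<i> * of_real R" "pathfinish A = \<i> * of_real R"
      "path_image A \<subseteq> S - \<real>\<^sub>\<le>\<^sub>0"
    and B: "valid_path B" "pathstart B = \<i> * of_real R" "pathfinish B = - \<i> * of_real R"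
      "path_image B \<subseteq> S - \<real>\<^sub>\<ge>\<^sub>0"
    and R: "R > 0" and S: "open S" "convex S" "0 \<in> S" and f: "f holomorphic_on S"
  shows "(\<lambda>z. f z / z) contour_integrable_on A" "(\<lambda>z. f z / z) contour_integrable_on B"
    "contour_integral A (\<lambda>z. f z / z) + contour_integral B (\<lambda>z. f z / z) = 2 * of_real pi * \<i> * f 0"
proof -
  have "0 \<notin> path_image A" "0 \<notin> path_image B" using A B by auto
  then have n0: "path_image (A +++ B) \<subseteq> S - {0}" and v: "valid_path (A +++ B)"
    using A B by (auto simp: path_image_join)
  have "((\<lambda>z. 1 / z) has_contour_integral (\<i> * of_real pi + \<i> * of_real pi)) (A +++ B)"
    using A B R
    by (intro has_contour_integral_join has_contour_integral_inverse_left[where R = R]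
          has_contour_integral_inverse_right[where R = R]) auto
  then have "contour_integral (A +++ B) (\<lambda>z. 1 / (z - 0)) = 2 * of_real pi * \<i>"
    using contour_integral_unique by fastforce
  then have w: "winding_number (A +++ B) 0 = 1"
    using v n0 by (subst winding_number_valid_path) auto
  have *: "((\<lambda>z. f z / (z - 0)) has_contour_integral (2 * pi * \<i> * winding_number (A +++ B) 0 * f 0)) (A +++ B)"
    using A B n0 v S f
    by (intro Cauchy_integral_formula_convex_simple[where S = S]) (auto simp: interior_open)
  then have "(\<lambda>z. f z / z) contour_integrable_on (A +++ B)"
    by (auto simp: contour_integrable_on_def)
  then show i: "(\<lambda>z. f z / z) contour_integrable_on A" "(\<lambda>z. f z / z) contour_integrable_on B"
    using A B by auto
  show "contour_integral A (\<lambda>z. f z / z) + contour_integral B (\<lambda>z. f z / z) = 2 * of_real pi * \<i> * f 0"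
    using contour_integral_unique[OF *] i A B w by simp
qed

text \<open>At parameter t the exponential has modulus exp(-d L t). Its integral supplies the factor
  1/(d L), although the modulus is 1 at the end on the imaginary axis.\<close>

lemma norm_contour_integral_linepath_exp_le:
  fixes k :: "complex \<Rightarrow> complex"
  assumes "Re a = 0" "Re b = - d" "d > 0" "L > 0"
    and k: "continuous_on (closed_segment a b) k" "\<And>z. z \<in> closed_segment a b \<Longrightarrow> norm (k z) \<le> M"
  shows "norm (contour_integral (linepath a b) (\<lambda>z. k z * exp (of_real L * z))) \<le> M * norm (b - a) / (d * L)"
proof -
  define K where "K = M * norm (b - a)"
  have M: "M \<ge> 0" using k(2)[of a] norm_ge_zero order_trans by (metis ends_in_segment(1))
  then have K: "K \<ge> 0" by (simp add: K_def)
  let ?f = "\<lambda>z. k z * exp (of_real L * z)"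
  have cont: "continuous_on (closed_segment a b) ?f"
    using k by (intro continuous_intros)
  then have "?f contour_integrable_on linepath a b"
    by (rule contour_integrable_continuous_linepath)
  then have int: "(\<lambda>t. ?f (linepath a b t) * (b - a)) integrable_on {0..1}"
    and eq: "contour_integral (linepath a b) ?f = integral {0..1} (\<lambda>t. ?f (linepath a b t) * (b - a))"
    by (auto simp: contour_integrable_on contour_integral_integral)
  have e: "((\<lambda>t. K * exp (- (d * L) * t)) has_integral
              ((- K / (d * L)) * exp (- (d * L) * 1) - (- K / (d * L)) * exp (- (d * L) * 0))) {0..1}"
    using assms
    by (intro fundamental_theorem_of_calculus)
       (auto intro!: derivative_eq_intros simp flip: has_real_derivative_iff_has_vector_derivative)
  have "norm (integral {0..1} (\<lambda>t. ?f (linepath a b t) * (b - a)))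
          \<le> integral {0..1} (\<lambda>t. K * exp (- (d * L) * t))"
  proof (rule Henstock_Kurzweil_Integration.integral_norm_bound_integral[OF int])
    show "(\<lambda>t. K * exp (- (d * L) * t)) integrable_on {0..1}"
      using e by (rule has_integral_integrable)
    fix t :: real assume t: "t \<in> {0..1}"
    then have "linepath a b t \<in> closed_segment a b"
      by (auto simp: linepath_in_path)
    moreover have "Re (linepath a b t) = - d * t"
      using assms by (simp add: linepath_def)
    ultimately show "norm (?f (linepath a b t) * (b - a)) \<le> K * exp (- (d * L) * t)"
      using mult_right_mono[OF k(2)[of "linepath a b t"], of "norm (b - a) * exp (- (d * L) * t)"]
      by (simp add: norm_mult K_def mult_ac)
  qed
  also have "\<dots> = K / (d * L) * (1 - exp (- (d * L)))"
    using integral_unique[OF e] by (simp add: algebra_simps)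
  also have "\<dots> \<le> K / (d * L) * 1"
    using assms K by (intro mult_left_mono) auto
  finally show ?thesis by (simp add: eq K_def)
qed

section \<open>Newman's contour argument\<close>

text \<open>For fixed R the right semicircle contributes C/R, the left one 2C/R, and the polygon,
  the only part to the left of the line, O(1/ln N). K depends on R, because g is controlled only on
  a compact set, but not on N.\<close>

lemma Newman_estimate:
  fixes a :: "nat \<Rightarrow> complex"
  assumes a: "\<And>n. norm (a n) \<le> C"
    and U: "open U" "{s. Re s \<ge> 1} \<subseteq> U" and g: "g holomorphic_on U"
    and sums: "\<And>s. Re s > 1 \<Longrightarrow> (\<lambda>n. a n * of_nat n powr -s) sums g s"
    and R: "R > 0"
  obtains K where "\<And>N. N \<ge> 2 \<Longrightarrow> real N \<ge> R \<Longrightarrow>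
    norm (g 1 - (\<Sum>n\<le>N. a n * of_nat n powr -1)) \<le> 3 * C / R + K / ln (real N)"
proof -
  have C: "C \<ge> 0" using a[of 0] norm_ge_zero order_trans by blast
  \<comment> \<open>Compactness of this piece of the line Re s = 1 yields one width e by which U
    extends beyond it; no width uniform in the height is available.\<close>
  define Y where "Y = closed_segment (Complex 1 (- (R + 1))) (Complex 1 (R + 1))"
  have YI: "Complex 1 y \<in> Y" if "\<bar>y\<bar> < R + 1" for y
    using that unfolding Y_def by (subst closed_segment_same_Re) (auto simp: closed_segment_eq_real_ivl)
  have "Re z = 1" if "z \<in> Y" for z
    using that unfolding Y_def by (subst (asm) closed_segment_same_Re) auto
  then have "Y \<subseteq> U" using U by force
  moreover have "compact Y" by (simp add: Y_def)
  ultimately obtain e where e: "e > 0" "(\<Union>x\<in>Y. cball x e) \<subseteq> U"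
    using compact_subset_open_imp_cball_epsilon_subset U(1) by metis
  \<comment> \<open>In the variable z = s - 1: a convex neighbourhood of 0 that contains the right
    semicircle and on which g(1 + z) is holomorphic.\<close>
  define V where "V = {z. Re z > - e \<and> \<bar>Im z\<bar> < R + 1}"
  have V_eq: "V = {z. Re z > - e} \<inter> {z. Im z < R + 1} \<inter> {z. Im z > - (R + 1)}"
    by (auto simp: V_def)
  have V: "open V" "convex V" "0 \<in> V"
    unfolding V_eq using R e
    by (auto intro!: open_halfspace_Re_gt open_halfspace_Im_gt open_halfspace_Im_lt
        convex_Int convex_halfspace_Re_gt convex_halfspace_Im_gt convex_halfspace_Im_lt)
  have VU: "1 + z \<in> U" if "z \<in> V" for z
  proof (cases "Re z \<ge> 0")
    case True
    then show ?thesis using U by auto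
  next
    case False
    have "1 + z - Complex 1 (Im z) = of_real (Re z)" by (simp add: complex_eq_iff)
    then have "dist (Complex 1 (Im z)) (1 + z) = \<bar>Re z\<bar>"
      by (metis dist_commute dist_norm norm_of_real)
    also have "\<dots> \<le> e" using False that by (auto simp: V_def)
    finally show ?thesis
      using e YI[of "Im z"] that by (force simp: V_def)
  qed
  have gV: "(\<lambda>z. g (1 + z)) holomorphic_on V"
    using VU by (intro holomorphic_on_compose_gen[OF _ g, unfolded o_def]) (auto intro!: holomorphic_intros)
  define d where "d = e / 2"
  have d: "d > 0" using e by (simp add: d_def)
  define ker :: "complex \<Rightarrow> complex" where "ker z = 1 + z\<^sup>2 / of_real R ^ 2" for z
  have ker_hol: "ker holomorphic_on T" for T
    using R unfolding ker_def by (auto intro!: holomorphic_intros)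
  define A where "A = part_circlepath 0 R (- (pi / 2)) (pi / 2)"
  define A' where "A' = part_circlepath 0 R (pi / 2) (3 * pi / 2)"
  define b1 where "b1 = \<i> * complex_of_real R"
  define b2 where "b2 = - \<i> * complex_of_real R"
  define b0 where "b0 = - complex_of_real d"
  \<comment> \<open>On both segments Re z moves linearly between 0 and -d, as the decay estimate
    demands; d = e / 2 keeps the corner inside V.\<close>
  define B where "B = linepath b1 b0 +++ linepath b0 b2"
  have ends: "pathstart A = b2" "pathfinish A = b1" "pathstart A' = b1" "pathfinish A' = b2"
  proof -
    have "exp (\<i> * of_real (- (pi / 2))) = - \<i>" "exp (\<i> * of_real (pi / 2)) = \<i>"
      "exp (\<i> * of_real (3 * pi / 2)) = - \<i>"
      unfolding cis_conv_exp[symmetric] using cos_3over2_pi sin_3over2_pi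
      by (simp_all add: complex_eq_iff)
    then show "pathstart A = b2" "pathfinish A = b1" "pathstart A' = b1" "pathfinish A' = b2"
      by (simp_all add: A_def A'_def b1_def b2_def mult_ac)
  qed
  have imA: "norm z = R \<and> Re z \<ge> 0" if "z \<in> path_image A" for z
    using that R unfolding A_def path_image_part_circlepath'
    by (auto simp: closed_segment_eq_real_ivl norm_mult intro!: cos_ge_zero mult_nonneg_nonneg)
  have imA': "norm z = R \<and> Re z \<le> 0" if "z \<in> path_image A'" for z
  proof -
    from that obtain x where x: "x \<in> {pi / 2..3 * pi / 2}" "z = of_real R * cis x"
      unfolding A'_def path_image_part_circlepath' by (auto simp: closed_segment_eq_real_ivl)
    have "cos (x - pi) \<ge> 0" using x by (intro cos_ge_zero) auto
    then have "cos x \<le> 0" by simp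
    with x R show ?thesis by (auto simp: norm_mult mult_le_0_iff)
  qed
  have imB1: "Re z < 0 \<or> z = b1" if z: "z \<in> closed_segment b1 b0" for z
  proof -
    from z obtain u where u: "0 \<le> u" "u \<le> 1" "z = (1 - u) *\<^sub>R b1 + u *\<^sub>R b0"
      by (auto simp: closed_segment_def)
    show ?thesis using u d by (cases "u = 0") (auto simp: b1_def b0_def)
  qed
  have imB2: "Re z < 0 \<or> z = b2" if z: "z \<in> closed_segment b2 b0" for z
  proof -
    from z obtain u where u: "0 \<le> u" "u \<le> 1" "z = (1 - u) *\<^sub>R b2 + u *\<^sub>R b0"
      by (auto simp: closed_segment_def)
    show ?thesis using u d by (cases "u = 0") (auto simp: b2_def b0_def)
  qed
  have bV: "b1 \<in> V" "b2 \<in> V" "b0 \<in> V"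
    using R d e by (auto simp: V_def b1_def b2_def b0_def d_def)
  then have segV: "closed_segment b1 b0 \<subseteq> V" "closed_segment b2 b0 \<subseteq> V"
    using V(2) by (auto simp: closed_segment_subset)
  have imB: "path_image B = closed_segment b1 b0 \<union> closed_segment b2 b0"
    unfolding B_def by (subst path_image_join) (auto simp: closed_segment_commute)
  have nonneg: "b1 \<notin> \<real>\<^sub>\<ge>\<^sub>0" "b2 \<notin> \<real>\<^sub>\<ge>\<^sub>0" 
    using R by (auto simp: b1_def b2_def complex_nonneg_Reals_iff)
  have nonneg': "Re z < 0 \<Longrightarrow> z \<notin> \<real>\<^sub>\<ge>\<^sub>0" for z
    by (auto simp: complex_nonneg_Reals_iff)
  have B: "valid_path B" "pathstart B = b1" "pathfinish B = b2" "path_image B \<subseteq> V - \<real>\<^sub>\<ge>\<^sub>0"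
  proof -
    have "z \<in> V - \<real>\<^sub>\<ge>\<^sub>0" if "z \<in> path_image B" for z
      using that segV imB1[of z] imB2[of z] nonneg nonneg'[of z] unfolding imB by blast
    then show "path_image B \<subseteq> V - \<real>\<^sub>\<ge>\<^sub>0" by blast
  qed (auto simp: B_def)
  have norm_0: "norm z = R \<Longrightarrow> Re z \<ge> 0 \<Longrightarrow> z \<notin> \<real>\<^sub>\<le>\<^sub>0" 
    "norm z = R \<Longrightarrow> Re z \<le> 0 \<Longrightarrow> z \<notin> \<real>\<^sub>\<ge>\<^sub>0" for z
    using R by (auto simp: complex_nonneg_Reals_iff complex_nonpos_Reals_iff cmod_def)
  have "\<bar>Im z\<bar> < R + 1" if "norm z = R" for z using abs_Im_le_cmod[of z] that by linarith
  then have A: "valid_path A" "path_image A \<subseteq> V - \<real>\<^sub>\<le>\<^sub>0" "path_image A \<subseteq> UNIV - \<real>\<^sub>\<le>\<^sub>0"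
    using imA norm_0 e by (force simp: A_def V_def)+
  have A': "valid_path A'" "path_image A' \<subseteq> UNIV - \<real>\<^sub>\<ge>\<^sub>0"
    using imA' norm_0 by (force simp: A'_def)+

  define k where "k z = g (1 + z) * ker z / z" for z
  have k_hol: "k holomorphic_on (V - {0})"
    unfolding k_def by (intro holomorphic_intros holomorphic_on_subset[OF gV] ker_hol) auto
  have k_cont: "continuous_on (closed_segment b1 b0 \<union> closed_segment b2 b0) k"
    using holomorphic_on_imp_continuous_on[OF k_hol] B(4) imB
    by (elim continuous_on_subset) auto
  then have "bounded (k ` (closed_segment b1 b0 \<union> closed_segment b2 b0))"
    by (intro compact_imp_bounded compact_continuous_image) auto
  then obtain M where M: "\<And>z. z \<in> closed_segment b1 b0 \<union> closed_segment b2 b0 \<Longrightarrow> norm (k z) \<le> M"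
    unfolding bounded_iff by blast
  define K where "K = (M * norm (b0 - b1) / d + M * norm (b0 - b2) / d) / (2 * pi)"
  show ?thesis
  proof (rule that[of K])
    fix N :: nat assume N: "N \<ge> 2" "real N \<ge> R"
    define L where "L = ln (real N)"
    have L: "L > 0" using N by (simp add: L_def)
    have norm_exp: "norm (exp (of_real L * z)) = real N powr Re z" for z
      using N by (simp add: L_def powr_def mult.commute)
    define S where "S s = (\<Sum>n\<le>N. a n * of_nat n powr -s)" for s
    define f1 where "f1 z = g (1 + z) * ker z * exp (of_real L * z)" for z
    define f2 where "f2 z = S (1 + z) * ker z * exp (of_real L * z)" for z
    have f1: "f1 holomorphic_on V"
      unfolding f1_def by (intro holomorphic_intros gV ker_hol)
    have f2: "f2 holomorphic_on UNIV"
      unfolding f2_def S_def by (intro holomorphic_intros ker_hol)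
    note C1 = Cauchy_formula_right_left[where R = R and A = A and B = B and S = V and f = f1,
        OF A(1) _ _ A(2) B(1) _ _ B(4) R V f1]
    note C2 = Cauchy_formula_right_left[where R = R and A = A and B = A' and S = UNIV and f = f2,
        OF A(1) _ _ A(3) A'(1) _ _ A'(2) R _ _ _ f2]
    have i1: "(\<lambda>z. f1 z / z) contour_integrable_on A"
      and c1: "contour_integral A (\<lambda>z. f1 z / z) + contour_integral B (\<lambda>z. f1 z / z) = 2 * of_real pi * \<i> * f1 0"
      using C1 ends B by (auto simp: b1_def b2_def)
    have i2: "(\<lambda>z. f2 z / z) contour_integrable_on A" "(\<lambda>z. f2 z / z) contour_integrable_on A'"
      and c2: "contour_integral A (\<lambda>z. f2 z / z) + contour_integral A' (\<lambda>z. f2 z / z) = 2 * of_real pi * \<i> * f2 0"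
      using C2 ends by (auto simp: b1_def b2_def)
    \<comment> \<open>With the weight exp(L z) = N^z, Cauchy's formula is used twice: for g around A
      and B, for the partial sum around the whole circle. On A only their difference, the tail of
      the series, remains.\<close>
    have split: "2 * of_real pi * \<i> * (f1 0 - f2 0) =
        contour_integral A (\<lambda>z. f1 z / z - f2 z / z) + contour_integral B (\<lambda>z. f1 z / z)
          - contour_integral A' (\<lambda>z. f2 z / z)"
      using c1 c2 i1 i2 by (simp add: contour_integral_diff algebra_simps)
    have bA: "norm (contour_integral A (\<lambda>z. f1 z / z - f2 z / z)) \<le> 2 * C / R\<^sup>2 * R * (pi / 2 - - (pi / 2))"
      unfolding A_def
    proof (rule has_contour_integral_bound_part_circlepath)
      show "((\<lambda>z. f1 z / z - f2 z / z) has_contour_integral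
              contour_integral (part_circlepath 0 R (- (pi / 2)) (pi / 2)) (\<lambda>z. f1 z / z - f2 z / z))
              (part_circlepath 0 R (- (pi / 2)) (pi / 2))"
        using i1 i2(1) unfolding A_def by (intro has_contour_integral_integral contour_integrable_diff)
      fix z assume "z \<in> path_image (part_circlepath 0 R (- (pi / 2)) (pi / 2))"
      then have z: "norm z = R" "Re z \<ge> 0" using imA by (auto simp: A_def)
      have "norm (f1 z / z - f2 z / z) = norm ((g (1 + z) - S (1 + z)) * (ker z / z) * exp (of_real L * z))"
        by (simp add: f1_def f2_def field_simps diff_divide_distrib)
      also have "\<dots> = norm (g (1 + z) - S (1 + z)) * (2 * Re z / R\<^sup>2) * real N powr Re z"
        using norm_Newman_kernel[OF z(1) R] z unfolding norm_mult norm_exp ker_def by simp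
      also have "\<dots> \<le> 2 * C / R\<^sup>2"
      proof (cases "Re z = 0")
        case True
        then show ?thesis using C by simp
      next
        case False
        then have x: "Re z > 0" using z by simp
        have "norm (g (1 + z) - S (1 + z)) \<le> C * real N powr (1 - Re (1 + z)) / (Re (1 + z) - 1)"
          unfolding S_def using N x by (intro dirichlet_series_tail_bound a sums) auto
        then have "norm (g (1 + z) - S (1 + z)) * (2 * Re z / R\<^sup>2) * real N powr Re z
          \<le> C * real N powr (- Re z) / Re z * (2 * Re z / R\<^sup>2) * real N powr Re z"
          using x by (intro mult_right_mono) auto
        also have "\<dots> = 2 * C / R\<^sup>2"
          using x N by (simp add: powr_minus field_simps)
        finally show ?thesis .
      qed
      finally show "norm (f1 z / z - f2 z / z) \<le> 2 * C / R\<^sup>2" .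
    qed (use C R in auto)
    have bA': "norm (contour_integral A' (\<lambda>z. f2 z / z)) \<le> 4 * C / R\<^sup>2 * R * (3 * pi / 2 - pi / 2)"
      unfolding A'_def
    proof (rule has_contour_integral_bound_part_circlepath)
      show "((\<lambda>z. f2 z / z) has_contour_integral
              contour_integral (part_circlepath 0 R (pi / 2) (3 * pi / 2)) (\<lambda>z. f2 z / z))
              (part_circlepath 0 R (pi / 2) (3 * pi / 2))"
        using i2(2) unfolding A'_def by (intro has_contour_integral_integral)
      fix z assume "z \<in> path_image (part_circlepath 0 R (pi / 2) (3 * pi / 2))"
      then have z: "norm z = R" "Re z \<le> 0" using imA' by (auto simp: A'_def)
      define x where "x = - Re z"
      have "norm (f2 z / z) = norm (S (1 + z) * (ker z / z) * exp (of_real L * z))"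
        by (simp add: f2_def)
      also have "\<dots> = norm (S (1 + z)) * (2 * x / R\<^sup>2) * real N powr (- x)"
        using norm_Newman_kernel[OF z(1) R] z unfolding norm_mult norm_exp ker_def x_def by simp
      also have "\<dots> \<le> 4 * C / R\<^sup>2"
      proof (cases "x = 0")
        case True
        then show ?thesis using C by simp
      next
        case False
        then have x: "x > 0" using z by (simp add: x_def)
        \<comment> \<open>Here N \<ge> R enters: the surplus term N^(x-1) of the partial sum bound
          is at most the main term N^x / x, whence the constant 4 in place of 2.\<close>
        have "x \<le> R" using abs_Re_le_cmod[of z] z by (simp add: x_def)
        then have xN: "x / real N \<le> 1" using N by (simp add: field_simps)
        have "norm (S (1 + z)) \<le> C * (real N powr (1 - Re (1 + z)) / (1 - Re (1 + z)) + real N powr (- Re (1 + z)))"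
          unfolding S_def using N x by (intro dirichlet_partial_sum_bound a) (auto simp: x_def)
        also have "\<dots> = C * (real N powr x / x + real N powr x / real N)"
          using N by (simp add: x_def powr_diff powr_minus field_simps)
        finally have "norm (S (1 + z)) * (2 * x / R\<^sup>2) * real N powr (- x)
          \<le> C * (real N powr x / x + real N powr x / real N) * (2 * x / R\<^sup>2) * real N powr (- x)"
          using x by (intro mult_right_mono) auto
        also have "\<dots> = 2 * C / R\<^sup>2 * (1 + x / real N)"
        proof -
          define P where "P = real N powr x"
          have "P > 0" using N by (simp add: P_def)
          then show ?thesis using x N R unfolding powr_minus P_def[symmetric] by (simp add: field_simps)
        qed
        also have "\<dots> \<le> 2 * C / R\<^sup>2 * 2"
          using C xN by (intro mult_left_mono) auto
        finally show ?thesis by simp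
      qed
      finally show "norm (f2 z / z) \<le> 4 * C / R\<^sup>2" .
    qed (use C R in auto)
    have f1k: "(\<lambda>z. f1 z / z) = (\<lambda>z. k z * exp (of_real L * z))"
      by (auto simp: f1_def k_def)
    have cont1: "continuous_on (closed_segment b1 b0) (\<lambda>z. k z * exp (of_real L * z))"
      and cont2: "continuous_on (closed_segment b2 b0) (\<lambda>z. k z * exp (of_real L * z))"
      by (intro continuous_intros continuous_on_subset[OF k_cont]; auto)+
    have cont2': "continuous_on (closed_segment b0 b2) (\<lambda>z. k z * exp (of_real L * z))"
      using cont2 by (simp add: closed_segment_commute)
    have "contour_integral B (\<lambda>z. f1 z / z) =
        contour_integral (linepath b1 b0) (\<lambda>z. k z * exp (of_real L * z))
        - contour_integral (linepath b2 b0) (\<lambda>z. k z * exp (of_real L * z))"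
      unfolding B_def f1k using contour_integral_reverse_linepath[OF cont2']
      by (subst contour_integral_join) (auto intro!: contour_integrable_continuous_linepath cont1 cont2')
    also have "norm \<dots> \<le> M * norm (b0 - b1) / (d * L) + M * norm (b0 - b2) / (d * L)"
      using M L d
      by (intro order_trans[OF norm_triangle_ineq4] add_mono norm_contour_integral_linepath_exp_le
          continuous_on_subset[OF k_cont])
         (auto simp: b0_def b1_def b2_def)
    also have "\<dots> = 2 * pi * (K / L)"
      using L d by (simp add: K_def field_simps)
    finally have bB: "norm (contour_integral B (\<lambda>z. f1 z / z)) \<le> 2 * pi * (K / L)" .
    have "f1 0 - f2 0 = g 1 - S 1" by (simp add: f1_def f2_def ker_def)
    then have "2 * pi * norm (g 1 - S 1) = norm (2 * of_real pi * \<i> * (f1 0 - f2 0))"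
      by (simp add: norm_mult)
    also have "\<dots> \<le> norm (contour_integral A (\<lambda>z. f1 z / z - f2 z / z))
        + norm (contour_integral B (\<lambda>z. f1 z / z)) + norm (contour_integral A' (\<lambda>z. f2 z / z))"
      unfolding split using norm_triangle_ineq4 norm_triangle_ineq by (smt (verit, best))
    also have "\<dots> \<le> 2 * C / R\<^sup>2 * R * (pi / 2 - - (pi / 2)) + 2 * pi * (K / L) + 4 * C / R\<^sup>2 * R * (3 * pi / 2 - pi / 2)"
      using bA bB bA' by linarith
    also have "\<dots> = 2 * pi * (3 * C / R + K / L)"
      using R by (simp add: field_simps power2_eq_square)
    finally have "norm (g 1 - S 1) \<le> 3 * C / R + K / L"
      by simp
    then show "norm (g 1 - (\<Sum>n\<le>N. a n * of_nat n powr -1)) \<le> 3 * C / R + K / ln (real N)"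
      by (simp add: S_def L_def)
  qed
qed

theorem Newman_Tauberian:
  fixes a :: "nat \<Rightarrow> complex"
  assumes a: "\<And>n. norm (a n) \<le> C"
    and U: "open U" "{s. Re s \<ge> 1} \<subseteq> U" and g: "g holomorphic_on U"
    and sums: "\<And>s. Re s > 1 \<Longrightarrow> (\<lambda>n. a n * of_nat n powr -s) sums g s"
  shows "(\<lambda>n. a n / of_nat n) sums g 1"
proof -
  have C: "C \<ge> 0" using a[of 0] norm_ge_zero order_trans by blast
  have "(\<lambda>N. \<Sum>n\<le>N. a n * of_nat n powr -1) \<longlonglongrightarrow> g 1"
  proof (rule tendstoI)
    fix e :: real assume e: "e > 0"
    \<comment> \<open>R is fixed before N grows. This choice puts 3 C / R below e / 2, and C + 1
      keeps R positive when C = 0.\<close>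
    define R where "R = 6 * (C + 1) / e"
    have R: "R > 0" using C e by (simp add: R_def)
    obtain K where K: "\<And>N. N \<ge> 2 \<Longrightarrow> real N \<ge> R \<Longrightarrow>
      norm (g 1 - (\<Sum>n\<le>N. a n * of_nat n powr -1)) \<le> 3 * C / R + K / ln (real N)"
      using Newman_estimate[OF a U g sums R] by blast
    have "3 * C / R < e / 2" using C e by (simp add: R_def field_simps)
    have "(\<lambda>N. K / ln (real N)) \<longlonglongrightarrow> 0"
      by (intro tendsto_divide_0[OF tendsto_const] filterlim_at_top_imp_at_infinity
          filterlim_compose[OF ln_at_top] filterlim_real_sequentially)
    then have "\<forall>\<^sub>F N in sequentially. K / ln (real N) < e / 2"
      using e by (intro order_tendstoD) auto
    moreover have "\<forall>\<^sub>F N in sequentially. N \<ge> 2 \<and> real N \<ge> R"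
      using eventually_ge_at_top[of "max 2 (nat \<lceil>R\<rceil>)"] by eventually_elim linarith
    ultimately show "\<forall>\<^sub>F N in sequentially. dist (\<Sum>n\<le>N. a n * of_nat n powr -1) (g 1) < e"
    proof eventually_elim
      case (elim N)
      then show ?case using K[of N] \<open>3 * C / R < e / 2\<close> unfolding dist_norm
        by (subst norm_minus_commute) linarith
    qed
  qed
  moreover have "a n * of_nat n powr -1 = a n / of_nat n" for n
    by (cases "n = 0") (auto simp: powr_minus field_simps)
  ultimately show ?thesis by (simp add: sums_def_le)
qed

section \<open>Analytic continuation of Dirichlet series\<close>

text \<open>
  The second-order Taylor remainder of \<open>x\<^bsup>1 - s\<^esup>\<close> at \<open>n\<close>. Telescoping shows that the remainders sum to
  \<open>(s - 1) \<zeta>(s)\<close>; as \<open>0 powr s = 0\<close>, the term for \<open>n = 0\<close> is the constant \<open>1\<close>.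
\<close>

definition powr_remainder :: "nat \<Rightarrow> complex \<Rightarrow> complex" where
  "powr_remainder n s = of_nat (Suc n) powr (1 - s) - of_nat n powr (1 - s) - (1 - s) * of_nat n powr (- s)"

text \<open>The second derivative of x^(1-s) is -s (1-s) x^(-s-1), largest in modulus at the left
  end n. Two powers are gained over x^(1-s), so the remainders are summable for Re s > 0.\<close>

lemma norm_powr_remainder_le:
  assumes n: "n > 0" and s: "Re s \<ge> 0"
  shows "norm (powr_remainder n s) \<le> norm s * norm (1 - s) * real n powr (- Re s - 1)"
proof -
  define f :: "nat \<Rightarrow> complex \<Rightarrow> complex" where
    "f i x = (if i = 0 then x powr (1 - s) else if i = 1 then (1 - s) * x powr (- s)
              else (1 - s) * (- s * x powr (- s - 1)))" for i x
  define S where "S = closed_segment (of_nat n) (of_nat (Suc n) :: complex)"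
  have S: "\<exists>y. x = of_real y \<and> y \<ge> real n" if "x \<in> S" for x
  proof -
    from that obtain u where "0 \<le> u" "x = (1 - u) *\<^sub>R of_nat n + u *\<^sub>R of_nat (Suc n)"
      by (auto simp: S_def closed_segment_def)
    then have "x = of_real (real n + u)" by (simp add: scaleR_conv_of_real algebra_simps)
    with \<open>0 \<le> u\<close> show ?thesis by (intro exI[of _ "real n + u"]) auto
  qed
  have "norm (f 0 (of_nat (Suc n)) - (\<Sum>i\<le>1. f i (of_nat n) * (of_nat (Suc n) - of_nat n) ^ i / fact i))
          \<le> norm s * norm (1 - s) * real n powr (- Re s - 1) * norm (of_nat (Suc n) - of_nat n :: complex) ^ Suc 1 / fact 1"
  proof (rule field_Taylor)
    show "convex S" "of_nat n \<in> S" "of_nat (Suc n) \<in> S" by (auto simp: S_def)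
  next
    fix i x assume x: "x \<in> S" and i: "i \<le> (1::nat)"
    have "x \<notin> \<real>\<^sub>\<le>\<^sub>0" using S[OF x] n by auto
    then show "(f i has_field_derivative f (Suc i) x) (at x within S)"
      using i by (cases "i = 0") (auto simp: f_def[abs_def] intro!: derivative_eq_intros)
  next
    fix x assume x: "x \<in> S"
    then obtain y where y: "x = of_real y" "y \<ge> real n" using S by blast
    have "norm (f (Suc 1) x) = norm s * norm (1 - s) * y powr (- Re s - 1)"
      using y n by (simp add: f_def norm_mult norm_powr_real_powr)
    also have "\<dots> \<le> norm s * norm (1 - s) * real n powr (- Re s - 1)"
      using y n s by (intro mult_left_mono powr_mono2') auto
    finally show "norm (f (Suc 1) x) \<le> norm s * norm (1 - s) * real n powr (- Re s - 1)" .
  qed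
  then show ?thesis by (simp add: f_def powr_remainder_def algebra_simps)
qed

lemma powr_diff_eq_remainder:
  assumes "n > 0"
  shows "of_nat n powr (- s) - of_nat (Suc n) powr (- s) = s * of_nat n powr (- (s + 1)) - powr_remainder n (s + 1)"
  by (simp add: powr_remainder_def algebra_simps)

text \<open>Abel summation in which the difference of consecutive powers is split into s n^(-s-1)
  and a remainder that converges one unit further to the left. With bounded partial sums this
  continues L; with linear ones it ties the series of \<psi>(n)/n to the logarithmic
  derivative.\<close>

lemma sums_by_parts:
  fixes a :: "nat \<Rightarrow> complex"
  defines "A \<equiv> \<lambda>n. \<Sum>k\<le>n. a k"
  assumes a0: "a 0 = 0" and A: "\<And>n. norm (A n) \<le> C * real n" and s: "Re s > 1"
    and X: "(\<lambda>n. A n * of_nat n powr (- (s + 1))) sums X"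
    and Y: "(\<lambda>n. A n * powr_remainder n (s + 1)) sums Y"
  shows "(\<lambda>n. a n * of_nat n powr (- s)) sums (s * X - Y)"
proof -
  have parts: "(\<Sum>n\<le>N. a n * of_nat n powr (- s)) =
      A N * of_nat (Suc N) powr (- s) + (\<Sum>n\<le>N. A n * (of_nat n powr (- s) - of_nat (Suc n) powr (- s)))" for N
  proof (induction N)
    case 0
    then show ?case by (simp add: A_def a0)
  next
    case (Suc N)
    have "A (Suc N) = A N + a (Suc N)" by (simp add: A_def)
    then show ?case using Suc by (simp add: algebra_simps del: of_nat_Suc)
  qed
  have C: "C \<ge> 0" using order_trans[OF norm_ge_zero A[of 1]] by simp
  have "(\<lambda>N. A N * of_nat (Suc N) powr (- s)) \<longlonglongrightarrow> 0"
  proof (rule Lim_null_comparison)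
    have "norm (A N * of_nat (Suc N) powr (- s)) \<le> C * real (Suc N) powr (1 - Re s)" for N
    proof -
      have "norm (A N * of_nat (Suc N) powr (- s)) \<le> (C * real (Suc N)) * real (Suc N) powr (- Re s)"
        unfolding norm_mult norm_nat_powr using A[of N] C
        by (intro mult_mono order_trans[OF A[of N]] mult_left_mono) auto
      also have "\<dots> = C * real (Suc N) powr (1 - Re s)"
        by (simp add: powr_diff powr_minus field_simps)
      finally show ?thesis .
    qed
    then show "\<forall>\<^sub>F N in sequentially. norm (A N * of_nat (Suc N) powr (- s)) \<le> C * real (Suc N) powr (1 - Re s)"
      by simp
    have "(\<lambda>N. real (Suc N) powr (1 - Re s)) \<longlonglongrightarrow> 0"
      using s by (intro tendsto_neg_powr filterlim_compose[OF filterlim_real_sequentially filterlim_Suc]) auto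
    then show "(\<lambda>N. C * real (Suc N) powr (1 - Re s)) \<longlonglongrightarrow> 0"
      by (rule tendsto_mult_right_zero)
  qed
  moreover have "A n * (of_nat n powr (- s) - of_nat (Suc n) powr (- s)) =
      s * (A n * of_nat n powr (- (s + 1))) - A n * powr_remainder n (s + 1)" for n
  proof (cases "n = 0")
    case True
    then show ?thesis using a0 by (simp add: A_def)
  next
    case False
    then show ?thesis using powr_diff_eq_remainder[of n s] by (simp only: right_diff_distrib mult.left_commute)
  qed
  then have "(\<lambda>n. A n * (of_nat n powr (- s) - of_nat (Suc n) powr (- s))) sums (s * X - Y)"
    using sums_diff[OF sums_mult[OF X, of s] Y] by simp
  then have "(\<lambda>N. \<Sum>n\<le>N. A n * (of_nat n powr (- s) - of_nat (Suc n) powr (- s))) \<longlonglongrightarrow> s * X - Y"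
    by (simp add: sums_def_le)
  ultimately have "(\<lambda>N. \<Sum>n\<le>N. a n * of_nat n powr (- s)) \<longlonglongrightarrow> 0 + (s * X - Y)"
    unfolding parts by (rule tendsto_add)
  then show ?thesis by (simp add: sums_def_le)
qed

text \<open>Weierstrass test on a disc of half the distance to the line Re s = 1. The differentiated
  series is returned as well, because logarithmic derivatives are read off from its coefficients
  c(n) ln n.\<close>

lemma dirichlet_series_converges:
  fixes c :: "nat \<Rightarrow> complex"
  assumes c: "\<And>n. norm (c n) \<le> C"
  obtains g g' where
    "\<And>s. Re s > 1 \<Longrightarrow> (\<lambda>n. c n * of_nat n powr (- s)) sums g s"
    "\<And>s. Re s > 1 \<Longrightarrow> (\<lambda>n. - (c n * ln (real n) * of_nat n powr (- s))) sums g' s"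
    "\<And>s. Re s > 1 \<Longrightarrow> (g has_field_derivative g' s) (at s)"
proof -
  have C: "C \<ge> 0" using c[of 0] norm_ge_zero order_trans by blast
  have "\<exists>g g'. \<forall>s\<in>{s. Re s > 1}. (\<lambda>n. c n * of_nat n powr (- s)) sums g s \<and>
      (\<lambda>n. - (c n * ln (real n) * of_nat n powr (- s))) sums g' s \<and> (g has_field_derivative g' s) (at s)"
  proof (rule series_and_derivative_comparison_complex)
    show "open {s. Re s > 1}" by (rule open_halfspace_Re_gt)
    show "((\<lambda>s. c n * of_nat n powr (- s)) has_field_derivative - (c n * ln (real n) * of_nat n powr (- s))) (at s)" for n s
    proof (cases "n = 0")
      case False
      then have "((\<lambda>s. of_nat n powr (- s)) has_field_derivative (Ln (of_nat n) * of_nat n powr (- s)) * (- 1)) (at s)"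
        by (intro DERIV_chain2[OF has_field_derivative_powr_right]) (auto intro!: derivative_eq_intros)
      from DERIV_cmult[OF this, of "c n"] False show ?thesis by (simp add: mult_ac)
    qed auto
  next
    fix s assume "s \<in> {s. Re s > 1}"
    define d where "d = (Re s - 1) / 2"
    have d: "d > 0" using \<open>s \<in> _\<close> by (simp add: d_def)
    show "\<exists>d h. 0 < d \<and> summable h \<and> range h \<subseteq> \<real>\<^sub>\<ge>\<^sub>0 \<and>
      (\<forall>\<^sub>F n in sequentially. \<forall>t\<in>ball s d \<inter> {s. 1 < Re s}. cmod (c n * of_nat n powr - t) \<le> cmod (h n))"
    proof (intro exI conjI)
      show "d > 0" by fact
      have "summable (\<lambda>n. C * real n powr (- 1 - d))"
        using d by (intro summable_mult) (simp add: summable_real_powr_iff)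
      then show "summable (\<lambda>n. complex_of_real (C * real n powr (- 1 - d)))" by (rule summable_of_real)
      show "range (\<lambda>n. complex_of_real (C * real n powr (- 1 - d))) \<subseteq> \<real>\<^sub>\<ge>\<^sub>0"
        using C by auto
      have "cmod (c n * of_nat n powr - t) \<le> cmod (complex_of_real (C * real n powr (- 1 - d)))"
        if "n \<ge> 1" "t \<in> ball s d" for n t
      proof -
        have "\<bar>Re (s - t)\<bar> < d" using that abs_Re_le_cmod[of "s - t"] by (auto simp: dist_norm)
        then have "Re t \<ge> 1 + d" using abs_ge_self[of "Re (s - t)"] by (simp add: d_def field_simps)
        then have "C * real n powr (- Re t) \<le> C * real n powr (- 1 - d)"
          using that C by (intro mult_left_mono powr_mono) auto
        moreover have "cmod (c n * of_nat n powr - t) \<le> C * real n powr (- Re t)"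
          unfolding norm_mult norm_nat_powr using c C by (intro mult_mono) auto
        moreover have "C * real n powr (- 1 - d) \<ge> 0" using C by simp
        ultimately show ?thesis by (simp only: norm_of_real)
      qed
      then show "\<forall>\<^sub>F n in sequentially. \<forall>t\<in>ball s d \<inter> {s. 1 < Re s}.
        cmod (c n * of_nat n powr - t) \<le> cmod (complex_of_real (C * real n powr (- 1 - d)))"
        by (intro eventually_mono[OF eventually_ge_at_top[of 1]]) blast
    qed
  qed
  then obtain g g' where "\<forall>s\<in>{s. Re s > 1}. (\<lambda>n. c n * of_nat n powr (- s)) sums g s \<and>
      (\<lambda>n. - (c n * ln (real n) * of_nat n powr (- s))) sums g' s \<and> (g has_field_derivative g' s) (at s)"
    by blast
  then show ?thesis by (intro that[of g g']) auto
qed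

text \<open>The remainders decay like n^(-Re s - 1), so coefficients of size n^a are tolerated for
  Re s > a: a = 0 serves \<zeta> and L, a = 1 serves \<psi>.\<close>

lemma remainder_series_converges:
  fixes c :: "nat \<Rightarrow> complex" and a :: real
  assumes c: "\<And>n. n > 0 \<Longrightarrow> norm (c n) \<le> C * real n powr a" and a: "a \<ge> 0"
  obtains g where
    "\<And>s. Re s > a \<Longrightarrow> (\<lambda>n. c n * powr_remainder n s) sums g s" "g holomorphic_on {s. Re s > a}"
proof -
  have C: "C \<ge> 0" using order_trans[OF norm_ge_zero c[of 1]] by simp
  have "\<exists>g. \<forall>s\<in>{s. Re s > a}. (\<lambda>n. c n * powr_remainder n s) sums g s \<and> g field_differentiable (at s)"
  proof (rule series_differentiable_comparison_complex)
    show "open {s. Re s > a}" by (rule open_halfspace_Re_gt)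
    show "(\<lambda>s. c n * powr_remainder n s) field_differentiable (at s)" for n s
      unfolding powr_remainder_def
      by (intro holomorphic_on_imp_differentiable_at[of _ UNIV] holomorphic_intros) auto
  next
    fix s assume "s \<in> {s. Re s > a}"
    define d where "d = (Re s - a) / 2"
    have d: "d > 0" using \<open>s \<in> _\<close> by (simp add: d_def)
    define B where "B = C * ((norm s + d) * (norm s + d + 1))"
    have B: "B \<ge> 0" using C d by (simp add: B_def)
    show "\<exists>d h. 0 < d \<and> summable h \<and> range h \<subseteq> \<real>\<^sub>\<ge>\<^sub>0 \<and>
      (\<forall>\<^sub>F n in sequentially. \<forall>t\<in>ball s d \<inter> {s. a < Re s}. cmod (c n * powr_remainder n t) \<le> cmod (h n))"
    proof (intro exI conjI)
      show "d > 0" by fact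
      have "summable (\<lambda>n. B * real n powr (- 1 - d))"
        using d by (intro summable_mult) (simp add: summable_real_powr_iff)
      then show "summable (\<lambda>n. complex_of_real (B * real n powr (- 1 - d)))" by (rule summable_of_real)
      show "range (\<lambda>n. complex_of_real (B * real n powr (- 1 - d))) \<subseteq> \<real>\<^sub>\<ge>\<^sub>0"
        using B by auto
      have "cmod (c n * powr_remainder n t) \<le> cmod (complex_of_real (B * real n powr (- 1 - d)))"
        if n: "n \<ge> 1" and t: "t \<in> ball s d" for n t
      proof -
        have "\<bar>Re (s - t)\<bar> < d" using t abs_Re_le_cmod[of "s - t"] by (auto simp: dist_norm)
        then have Re: "Re t \<ge> a + d" using abs_ge_self[of "Re (s - t)"] by (simp add: d_def field_simps)
        have nt: "norm t \<le> norm s + d"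
          using t norm_triangle_ineq2[of t s] by (simp add: dist_norm norm_minus_commute)
        have nt': "norm (1 - t) \<le> norm s + d + 1"
          using nt norm_triangle_ineq4[of 1 t] by simp
        have "norm (c n * powr_remainder n t)
                \<le> (C * real n powr a) * (norm t * norm (1 - t) * real n powr (- Re t - 1))"
          unfolding norm_mult using n Re a d C
          by (intro mult_mono c norm_powr_remainder_le) auto
        also have "\<dots> \<le> (C * real n powr a) * ((norm s + d) * (norm s + d + 1) * real n powr (- a - d - 1))"
          using n Re nt nt' C d by (intro mult_mono mult_left_mono powr_mono) auto
        also have "\<dots> = B * (real n powr a * real n powr (- a - d - 1))"
          by (simp add: B_def)
        also have "real n powr a * real n powr (- a - d - 1) = real n powr (- 1 - d)"
          by (subst powr_add[symmetric]) (simp add: algebra_simps)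
        finally show ?thesis using B by (simp only: norm_of_real)
      qed
      then show "\<forall>\<^sub>F n in sequentially. \<forall>t\<in>ball s d \<inter> {s. a < Re s}.
        cmod (c n * powr_remainder n t) \<le> cmod (complex_of_real (B * real n powr (- 1 - d)))"
        by (intro eventually_mono[OF eventually_ge_at_top[of 1]]) blast
    qed
  qed blast
  then obtain g where g: "\<forall>s\<in>{s. Re s > a}. (\<lambda>n. c n * powr_remainder n s) sums g s \<and> g field_differentiable (at s)"
    by blast
  show ?thesis
  proof (rule that[of g])
    show "g holomorphic_on {s. Re s > a}"
      using g by (auto simp: holomorphic_on_def intro: field_differentiable_at_within)
  qed (use g in auto)
qed

lemma nat_powr_mult: "(of_nat (m * n) :: complex) powr s = of_nat m powr s * of_nat n powr s"
  by (simp add: powr_times_real)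

text \<open>Real part of the differentiated Dirichlet series with all coefficients 1, at a real
  point.\<close>

lemma summable_ln_powr:
  fixes x :: real
  assumes "x > 1"
  shows "summable (\<lambda>n. ln (real n) * real n powr (- x))"
proof -
  have "\<exists>g'::complex \<Rightarrow> complex. \<forall>s. Re s > 1 \<longrightarrow> (\<lambda>n. - (1 * complex_of_real (ln (real n)) * of_nat n powr (- s))) sums g' s"
  proof (rule dirichlet_series_converges[of "\<lambda>_. 1" 1])
    fix g' :: "complex \<Rightarrow> complex"
    assume "\<And>s. Re s > 1 \<Longrightarrow> (\<lambda>n. - (1 * complex_of_real (ln (real n)) * of_nat n powr (- s))) sums g' s"
    then show ?thesis by (intro exI[of _ g'] allI impI)
  qed simp
  then obtain g' :: "complex \<Rightarrow> complex"
    where g: "\<And>s::complex. Re s > 1 \<Longrightarrow> (\<lambda>n. - (1 * complex_of_real (ln (real n)) * of_nat n powr (- s))) sums g' s"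
    by blast
  have "(\<lambda>n. Re (- (1 * complex_of_real (ln (real n)) * of_nat n powr (- of_real x)))) sums Re (g' (of_real x))"
    using g[of "of_real x"] assms by (intro sums_Re) auto
  moreover have "Re (- (1 * complex_of_real (ln (real n)) * of_nat n powr (- of_real x))) = - (ln (real n) * real n powr (- x))" for n
    using powr_of_real[of "real n" "- x"] by simp
  ultimately have "summable (\<lambda>n. - (ln (real n) * real n powr (- x)))"
    by (auto simp only: sums_iff)
  then show ?thesis by (simp add: summable_minus_iff)
qed

text \<open>The sum of \<Lambda> over the divisors of n is ln n, and complete multiplicativity lets
  f(n) be pulled out of the convolution of f with f \<Lambda>. In terms of functions this is -F' = F
  M.\<close>

lemma sums_mult_mangoldt:
  fixes f :: "nat \<Rightarrow> complex"
  assumes mult: "\<And>m n. f (m * n) = f m * f n" and f: "\<And>n. norm (f n) \<le> 1" and s: "Re s > 1"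
    and F: "(\<lambda>n. f n * of_nat n powr (- s)) sums F"
    and M: "(\<lambda>n. f n * mangoldt n * of_nat n powr (- s)) sums M"
  shows "(\<lambda>n. f n * ln (real n) * of_nat n powr (- s)) sums (F * M)"
proof -
  define u where "u n = f n * of_nat n powr (- s)" for n
  define v where "v n = f n * mangoldt n * of_nat n powr (- s)" for n
  have nu: "summable (\<lambda>n. norm (u n))"
  proof (rule summable_comparison_test')
    show "summable (\<lambda>n. real n powr (- Re s))" using s by (simp add: summable_real_powr_iff)
    show "norm (norm (u n)) \<le> real n powr (- Re s)" if "n \<ge> 0" for n
      using f[of n] mult_right_mono[OF f[of n], of "real n powr (- Re s)"]
      by (simp add: u_def norm_mult norm_nat_powr)
  qed
  have nv: "summable (\<lambda>n. norm (v n))"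
  proof (rule summable_comparison_test')
    show "summable (\<lambda>n. ln (real n) * real n powr (- Re s))" by (rule summable_ln_powr[OF s])
    show "norm (norm (v n)) \<le> ln (real n) * real n powr (- Re s)" if "n \<ge> 1" for n
    proof -
      have "norm (f n) * mangoldt n \<le> 1 * ln (real n)"
        using that f[of n] mangoldt_le[of n] by (intro mult_mono) (auto simp: mangoldt_nonneg)
      then show ?thesis by (simp add: v_def norm_mult norm_nat_powr abs_mult mult_right_mono)
    qed
  qed
  have hu: "(u has_sum F) UNIV" and hv: "(v has_sum M) UNIV"
    using norm_summable_imp_has_sum[OF nu, of F] norm_summable_imp_has_sum[OF nv, of M] F M
    unfolding u_def[symmetric] v_def[symmetric] by auto
  have absu: "(\<lambda>n. norm (u n)) summable_on UNIV" and absv: "(\<lambda>n. norm (v n)) summable_on UNIV"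
    using nu nv by (simp_all add: summable_on_UNIV_nonneg_real_iff)
  have "(\<lambda>p. norm (case p of (x, y) \<Rightarrow> u x * v y)) summable_on (SIGMA x:UNIV. UNIV)"
    unfolding Infinite_Sum.abs_summable_on_Sigma_iff
    using absu absv
    by (auto simp: norm_mult abs_mult infsum_cmult_right' intro!: summable_on_cmult_right summable_on_cmult_left)
  then have summ: "(\<lambda>(x, y). u x * v y) summable_on (SIGMA x:UNIV. UNIV)"
    by (rule abs_summable_summable)
  have "((\<lambda>(x, y). u x * v y) has_sum (F * M)) (SIGMA x:UNIV. UNIV)"
    by (rule has_sum_SigmaI[where g = "\<lambda>x. u x * M", OF _ _ summ])
       (auto intro!: has_sum_cmult_right has_sum_cmult_left hu hv)
  \<comment> \<open>Pairs with a zero coordinate contribute nothing, as 0 to any power is 0 here.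
    Without them each product has finitely many factorizations, and the double sum can be sorted by
    products.\<close>
  also have "?this \<longleftrightarrow> ((\<lambda>(x, y). u x * v y) has_sum (F * M)) ({0<..} \<times> {0<..})"
    by (rule has_sum_cong_neutral) (auto simp: u_def v_def)
  also have "\<dots> \<longleftrightarrow> ((\<lambda>(n, d). u (n div d) * v d) has_sum (F * M)) (SIGMA n:{0<..}. {d. d dvd n})"
    by (rule has_sum_reindex_bij_witness[of _ "\<lambda>(n, d). (n div d, d)" "\<lambda>(x, y). (x * y, y)"])
       (auto simp: dvd_div_eq_0_iff dvd_pos_nat elim!: dvdE)
  finally have *: "((\<lambda>(n, d). u (n div d) * v d) has_sum (F * M)) (SIGMA n:{0<..}. {d. d dvd n})" .
  have "((\<lambda>n. f n * ln (real n) * of_nat n powr (- s)) has_sum (F * M)) {0<..}"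
  proof (rule has_sum_SigmaD[OF *])
    fix n :: nat assume "n \<in> {0<..}"
    then have n: "n > 0" by simp
    have "(\<Sum>d | d dvd n. u (n div d) * v d) = (\<Sum>d | d dvd n. (f n * of_nat n powr (- s)) * mangoldt d)"
    proof (rule sum.cong)
      fix d assume "d \<in> {d. d dvd n}"
      then have nd: "n = (n div d) * d" by auto
      have "f n * of_nat n powr (- s) = (f (n div d) * f d) * (of_nat (n div d) powr (- s) * of_nat d powr (- s))"
        by (subst (1 2) nd) (simp only: nat_powr_mult mult)
      then show "u (n div d) * v d = (f n * of_nat n powr (- s)) * mangoldt d"
        by (simp add: u_def v_def)
    qed simp
    also have "\<dots> = f n * ln (real n) * of_nat n powr (- s)"
      using n by (simp flip: sum_distrib_left add: mangoldt_sum)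
    finally show "((\<lambda>d. case (n, d) of (n, d) \<Rightarrow> u (n div d) * v d) has_sum f n * ln (real n) * of_nat n powr (- s)) {d. d dvd n}"
      using n by (auto intro!: has_sum_finiteI)
  qed
  also have "?this \<longleftrightarrow> ((\<lambda>n. f n * ln (real n) * of_nat n powr (- s)) has_sum (F * M)) UNIV"
    by (rule has_sum_cong_neutral) auto
  finally show ?thesis by (rule has_sum_imp_sums)
qed

text \<open>The factor s - 1 removes the pole. At s = 1 all remainders with n > 0 vanish, so the
  residue of \<zeta> appears as the contribution of n = 0 alone.\<close>

lemma zeta_continuation:
  obtains Z where "Z holomorphic_on {s. Re s > 0}" "Z 1 = 1"
    "\<And>s. Re s > 1 \<Longrightarrow> (\<lambda>n. of_nat n powr (- s)) sums (Z s / (s - 1))"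
proof -
  obtain Z where Z: "\<And>s. Re s > 0 \<Longrightarrow> (\<lambda>n. powr_remainder n s) sums Z s"
    and hol: "Z holomorphic_on {s. Re s > 0}"
    using remainder_series_converges[of "\<lambda>_. 1" 1 0] by auto
  show ?thesis
  proof (rule that[OF hol])
    have "powr_remainder n 1 = 0" if "n \<notin> {0}" for n
      using that by (auto simp: powr_remainder_def simp del: of_nat_Suc)
    then have "(\<lambda>n. powr_remainder n 1) sums (\<Sum>n\<in>{0}. powr_remainder n 1)"
      by (intro sums_finite) auto
    also have "(\<Sum>n\<in>{0}. powr_remainder n 1) = 1"
      by (simp add: powr_remainder_def)
    finally show "Z 1 = 1" using Z[of 1] by (simp add: sums_iff)
  next
    fix s :: complex assume s: "Re s > 1"
    then have s1: "s \<noteq> 1" by auto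
    have "(\<lambda>n. (of_nat n :: complex) powr (1 - s)) \<longlonglongrightarrow> 0"
    proof (rule tendsto_norm_zero_cancel)
      show "(\<lambda>n. norm ((of_nat n :: complex) powr (1 - s))) \<longlonglongrightarrow> 0"
        unfolding norm_nat_powr using s by (intro tendsto_neg_powr filterlim_real_sequentially) auto
    qed
    from telescope_sums[OF this]
    have t: "(\<lambda>n. of_nat (Suc n) powr (1 - s) - of_nat n powr (1 - s)) sums 0" by simp
    have "(\<lambda>n. (powr_remainder n s - (of_nat (Suc n) powr (1 - s) - of_nat n powr (1 - s))) / (s - 1)) sums ((Z s - 0) / (s - 1))"
      using s by (intro sums_divide sums_diff Z t) auto
    moreover have "(powr_remainder n s - (of_nat (Suc n) powr (1 - s) - of_nat n powr (1 - s))) / (s - 1) = of_nat n powr (- s)" for n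
      using s1 by (simp add: powr_remainder_def field_simps)
    ultimately show "(\<lambda>n. of_nat n powr (- s)) sums (Z s / (s - 1))" by simp
  qed
qed

section \<open>The character modulo 8 and its L-function\<close>

text \<open>The Kronecker symbol of 2: on odd primes p it tells whether p splits in
  \<int>[\<surd>2]. Given by residues, it reduces multiplicativity and partial sums to finite
  checks.\<close>

definition chi8 :: "nat \<Rightarrow> int" where
  "chi8 n = (if n mod 8 \<in> {1, 7} then 1 else if n mod 8 \<in> {3, 5} then -1 else 0)"

lemma mod_8_cases:
  fixes n :: nat
  obtains "n mod 8 = 0" | "n mod 8 = 1" | "n mod 8 = 2" | "n mod 8 = 3"
    | "n mod 8 = 4" | "n mod 8 = 5" | "n mod 8 = 6" | "n mod 8 = 7"
proof -
  have "n mod 8 < 8" by simp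
  then show ?thesis using that by linarith
qed

lemma chi8_mult: "chi8 (m * n) = chi8 m * chi8 n"
proof -
  have *: "m * n mod 8 = ((m mod 8) * (n mod 8)) mod 8" by (simp add: mod_mult_eq)
  show ?thesis
    unfolding chi8_def * by (cases m rule: mod_8_cases; cases n rule: mod_8_cases) simp_all
qed

lemma abs_chi8_le: "\<bar>chi8 n\<bar> \<le> 1"
  by (simp add: chi8_def)

lemma sum_chi8:
  "(\<Sum>k\<le>n. chi8 k) = (if n mod 8 \<in> {1, 2} then 1 else if n mod 8 \<in> {5, 6} then -1 else 0)"
proof (induction n)
  case 0
  then show ?case by (simp add: chi8_def)
next
  case (Suc n)
  have "Suc n mod 8 = Suc (n mod 8) mod 8" by (simp add: mod_Suc_eq)
  then show ?case unfolding sum.atMost_Suc Suc.IH chi8_def[of "Suc n"]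
    by (cases n rule: mod_8_cases) simp_all
qed

text \<open>Partial summation trades \<open>chi8\<close> for its bounded partial sums and s for s +
  1, so both series converge for Re s > 0. At s = 1 the same expression is a real series of explicit
  fractions.\<close>

lemma L_continuation:
  obtains L where "L holomorphic_on {s. Re s > 0}" "L 1 \<noteq> 0"
    "\<And>s. Re s > 1 \<Longrightarrow> (\<lambda>n. of_int (chi8 n) * of_nat n powr (- s)) sums L s"
proof -
  define X :: "nat \<Rightarrow> int" where "X n = (\<Sum>k\<le>n. chi8 k)" for n
  have X: "norm (of_int (X n) :: complex) \<le> 1" for n
    by (simp add: X_def sum_chi8)
  obtain g g' where g: "\<And>s. Re s > 1 \<Longrightarrow> (\<lambda>n. of_int (X n) * of_nat n powr (- s)) sums g s"
    "\<And>s. Re s > 1 \<Longrightarrow> (g has_field_derivative g' s) (at s)"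
    using dirichlet_series_converges[of "\<lambda>n. of_int (X n)" 1] X by metis
  obtain h where h: "\<And>s. Re s > 0 \<Longrightarrow> (\<lambda>n. of_int (X n) * powr_remainder n s) sums h s"
    "h holomorphic_on {s. Re s > 0}"
    using remainder_series_converges[of "\<lambda>n. of_int (X n)" 1 0] X by auto
  have ghol: "g holomorphic_on {s. Re s > 1}"
    using g(2) by (auto simp: holomorphic_on_open open_halfspace_Re_gt)
  define L where "L s = s * g (s + 1) - h (s + 1)" for s
  show ?thesis
  proof (rule that[of L])
    have "(\<lambda>s. g (s + 1)) holomorphic_on {s. Re s > 0}" "(\<lambda>s. h (s + 1)) holomorphic_on {s. Re s > 0}"
      by (rule holomorphic_on_compose_gen[unfolded o_def, OF _ ghol] holomorphic_on_compose_gen[unfolded o_def, OF _ h(2)];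
          auto intro!: holomorphic_intros)+
    then show "L holomorphic_on {s. Re s > 0}"
      unfolding L_def by (intro holomorphic_intros)
  next
    fix s :: complex assume s: "Re s > 1"
    show "(\<lambda>n. of_int (chi8 n) * of_nat n powr (- s)) sums L s"
      unfolding L_def
    proof (rule sums_by_parts)
      have X': "(\<Sum>k\<le>n. of_int (chi8 k)) = (of_int (X n) :: complex)" for n by (simp add: X_def)
      show "cmod (\<Sum>k\<le>n. of_int (chi8 k)) \<le> 1 * real n" for n
        unfolding X' using X[of n] by (cases "n = 0") (auto simp: X_def chi8_def)
      show "(\<lambda>n. (\<Sum>k\<le>n. of_int (chi8 k)) * of_nat n powr - (s + 1)) sums g (s + 1)"
        "(\<lambda>n. (\<Sum>k\<le>n. of_int (chi8 k)) * powr_remainder n (s + 1)) sums h (s + 1)"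
        unfolding X' using s by (intro g h; simp)+
    qed (use s in \<open>auto simp: chi8_def\<close>)
  next
    \<comment> \<open>Grouped modulo \<open>8\<close>, the series of \<open>L(1, \<chi>)\<close> has positive terms.\<close>
    define w where "w n = of_int (X n) * (1 / real n - 1 / real (Suc n))" for n
    have "(\<lambda>n. of_int (X n) * of_nat n powr (- (1 + 1)) - of_int (X n) * powr_remainder n (1 + 1)) sums L 1"
      unfolding L_def using g(1)[of "1 + 1"] h(1)[of "1 + 1"] by (auto intro!: sums_diff)
    moreover have "of_int (X n) * of_nat n powr (- (1 + 1)) - of_int (X n) * powr_remainder n (1 + 1) = complex_of_real (w n)" for n
    proof (cases "n = 0")
      case True
      then show ?thesis by (simp add: X_def chi8_def w_def)
    next
      case False
      then have "of_nat n powr (- 1 :: complex) - of_nat (Suc n) powr - 1 = 1 * of_nat n powr (- (1 + 1)) - powr_remainder n (1 + 1)"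
        by (intro powr_diff_eq_remainder) auto
      moreover have "of_nat n powr (- 1 :: complex) - of_nat (Suc n) powr - 1 = of_real (1 / real n - 1 / real (Suc n))"
        using False by (simp add: powr_minus field_simps del: of_nat_Suc)
      ultimately show ?thesis
        by (simp add: w_def right_diff_distrib[symmetric] del: of_nat_Suc)
    qed
    ultimately have "(\<lambda>n. complex_of_real (w n)) sums L 1" by simp
    from sums_Re[OF this] have w: "w sums Re (L 1)" by simp
    from sums_group[OF this, of 8] have "(\<lambda>k. sum w {k * 8..<k * 8 + 8}) sums Re (L 1)" by simp
    \<comment> \<open>In a block the partial sums are 1 at 8k+1, 8k+2 and -1 at 8k+5, 8k+6, so the
      terms telescope to the drops of 1/n from 8k+1 to 8k+3 and from 8k+5 to 8k+7; the later drop is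
      smaller.\<close>
    moreover have grp: "sum w {k * 8..<k * 8 + 8} = (1 / (8 * real k + 1) - 1 / (8 * real k + 3)) - (1 / (8 * real k + 5) - 1 / (8 * real k + 7))" for k
    proof -
      have "sum w {k * 8..<k * 8 + 8} = (\<Sum>j<8. w (8 * k + j))"
        by (rule sum.reindex_bij_witness[of _ "\<lambda>j. 8 * k + j" "\<lambda>i. i - 8 * k"]) auto
      also have "\<dots> = (\<Sum>j<8. of_int (if j \<in> {1, 2} then 1 else if j \<in> {5, 6} then - 1 else 0) *
          (1 / (8 * real k + real j) - 1 / (8 * real k + real (Suc j))))"
        by (intro sum.cong) (auto simp: w_def X_def sum_chi8 add_ac)
      also have "\<dots> = (1 / (8 * real k + 1) - 1 / (8 * real k + 3)) - (1 / (8 * real k + 5) - 1 / (8 * real k + 7))"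
        by (simp add: eval_nat_numeral lessThan_Suc)
      finally show ?thesis .
    qed
    moreover have "(1 / (8 * real k + 1) - 1 / (8 * real k + 3)) - (1 / (8 * real k + 5) - 1 / (8 * real k + 7)) > 0" for k
    proof -
      have "1 / (8 * real k + 5) - 1 / (8 * real k + 7) = 2 / ((8 * real k + 5) * (8 * real k + 7))"
        by (simp add: field_simps add_pos_nonneg add_nonneg_eq_0_iff)
      also have "\<dots> < 2 / ((8 * real k + 1) * (8 * real k + 3))"
        by (intro divide_strict_left_mono mult_strict_mono) (auto intro!: mult_pos_pos)
      also have "\<dots> = 1 / (8 * real k + 1) - 1 / (8 * real k + 3)"
        by (simp add: field_simps add_pos_nonneg add_nonneg_eq_0_iff)
      finally show ?thesis by simp
    qed
    ultimately have "Re (L 1) > 0"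
      by (metis (no_types, lifting) sums_iff suminf_pos)
    then show "L 1 \<noteq> 0" by auto
  qed
qed

section \<open>Logarithms of Dirichlet series\<close>

text \<open>H plays the role of ln g, but only g' = g H' is asserted, which comes straight from the
  convolution identity. At n = 0 and n = 1 the quotient \<Lambda>(n) / ln n is 0 by convention, so
  multiplying by ln n still returns \<Lambda>(n).\<close>

lemma dirichlet_log_derivative:
  fixes f :: "nat \<Rightarrow> complex"
  assumes mult: "\<And>m n. f (m * n) = f m * f n" and f: "\<And>n. norm (f n) \<le> 1"
  obtains g H H' where
    "\<And>s. Re s > 1 \<Longrightarrow> (\<lambda>n. f n * of_nat n powr (- s)) sums g s"
    "\<And>s. Re s > 1 \<Longrightarrow> (\<lambda>n. f n * of_real (mangoldt n / ln (real n)) * of_nat n powr (- s)) sums H s"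
    "\<And>s. Re s > 1 \<Longrightarrow> (\<lambda>n. f n * mangoldt n * of_nat n powr (- s)) sums (- H' s)"
    "\<And>s. Re s > 1 \<Longrightarrow> (H has_field_derivative H' s) (at s)"
    "\<And>s. Re s > 1 \<Longrightarrow> (g has_field_derivative g s * H' s) (at s)"
proof -
  obtain g g' where g: "\<And>s. Re s > 1 \<Longrightarrow> (\<lambda>n. f n * of_nat n powr (- s)) sums g s"
    "\<And>s. Re s > 1 \<Longrightarrow> (\<lambda>n. - (f n * of_real (ln (real n)) * of_nat n powr (- s))) sums g' s"
    "\<And>s. Re s > 1 \<Longrightarrow> (g has_field_derivative g' s) (at s)"
    using dirichlet_series_converges[of f 1] f by blast
  define c where "c n = f n * of_real (mangoldt n / ln (real n))" for n
  have "norm (c n) \<le> 1" for n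
  proof -
    have "\<bar>mangoldt n / ln (real n)\<bar> \<le> 1"
    proof (cases "n \<ge> 2")
      case True
      then show ?thesis using mangoldt_le[of n] mangoldt_nonneg[of n] by (simp add: field_simps)
    next
      case False
      then have "n = 0 \<or> n = 1" by auto
      then show ?thesis by auto
    qed
    then have "norm (f n) * \<bar>mangoldt n / ln (real n)\<bar> \<le> 1 * 1" using f[of n] by (intro mult_mono) (auto simp: mangoldt_nonneg)
    then show ?thesis unfolding c_def norm_mult norm_of_real by simp
  qed
  then obtain H H' where H: "\<And>s. Re s > 1 \<Longrightarrow> (\<lambda>n. c n * of_nat n powr (- s)) sums H s"
    "\<And>s. Re s > 1 \<Longrightarrow> (\<lambda>n. - (c n * of_real (ln (real n)) * of_nat n powr (- s))) sums H' s"
    "\<And>s. Re s > 1 \<Longrightarrow> (H has_field_derivative H' s) (at s)"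
    using dirichlet_series_converges[of c 1] by blast
  have c_ln: "c n * of_real (ln (real n)) = f n * mangoldt n" for n
  proof (cases "n \<ge> 2")
    case True
    then show ?thesis by (simp add: c_def)
  next
    case False
    then have "n = 0 \<or> n = 1" by auto
    then show ?thesis by (auto simp: c_def)
  qed
  have M: "(\<lambda>n. f n * mangoldt n * of_nat n powr (- s)) sums (- H' s)" if "Re s > 1" for s
    using sums_minus[OF H(2)[OF that]] by (simp add: c_ln)
  show ?thesis
  proof (rule that[OF g(1) _ M H(3)])
    fix s :: complex assume s: "Re s > 1"
    show "(\<lambda>n. f n * of_real (mangoldt n / ln (real n)) * of_nat n powr (- s)) sums H s"
      using H(1)[OF s] by (simp add: c_def)
    have "(\<lambda>n. f n * of_real (ln (real n)) * of_nat n powr (- s)) sums (g s * - H' s)"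
      by (rule sums_mult_mangoldt[OF mult f s g(1)[OF s] M[OF s]])
    from sums_minus[OF this] have "g' s = g s * H' s"
      using sums_unique2[OF g(2)[OF s]] by simp
    then show "(g has_field_derivative g s * H' s) (at s)"
      using g(3)[OF s] by simp
  qed
qed

text \<open>Adding the cases f = 1 and f = \<chi> gives the weights \<Lambda> (1 + \<chi>). The
  product g1 g2 exp(-G) has derivative 0 on a half-plane, hence is constant there, and D = Z L
  continues (s - 1) g1 g2.\<close>

lemma zetaK_continuation:
  obtains D c G G' where
    "D holomorphic_on {s. Re s > 0}" "D 1 \<noteq> 0" "c \<noteq> 0"
    "\<And>s. Re s > 1 \<Longrightarrow> D s = (s - 1) * c * exp (G s)"
    "\<And>s. Re s > 1 \<Longrightarrow> (G has_field_derivative G' s) (at s)"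
    "\<And>s. Re s > 1 \<Longrightarrow> (\<lambda>n. of_real (mangoldt n * (1 + of_int (chi8 n)) / ln (real n)) * of_nat n powr (- s)) sums G s"
    "\<And>s. Re s > 1 \<Longrightarrow> (\<lambda>n. of_real (mangoldt n * (1 + of_int (chi8 n))) * of_nat n powr (- s)) sums (- G' s)"
proof -
  obtain Z where Z: "Z holomorphic_on {s. Re s > 0}" "Z 1 = 1"
    "\<And>s. Re s > 1 \<Longrightarrow> (\<lambda>n. of_nat n powr (- s)) sums (Z s / (s - 1))"
    using zeta_continuation by blast
  obtain L where L: "L holomorphic_on {s. Re s > 0}" "L 1 \<noteq> 0"
    "\<And>s. Re s > 1 \<Longrightarrow> (\<lambda>n. of_int (chi8 n) * of_nat n powr (- s)) sums L s"
    using L_continuation by blast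
  obtain g1 H1 H1' where 1:
    "\<And>s. Re s > 1 \<Longrightarrow> (\<lambda>n. 1 * of_nat n powr (- s)) sums g1 s"
    "\<And>s. Re s > 1 \<Longrightarrow> (\<lambda>n. 1 * of_real (mangoldt n / ln (real n)) * of_nat n powr (- s)) sums H1 s"
    "\<And>s. Re s > 1 \<Longrightarrow> (\<lambda>n. 1 * mangoldt n * of_nat n powr (- s)) sums (- H1' s)"
    "\<And>s. Re s > 1 \<Longrightarrow> (H1 has_field_derivative H1' s) (at s)"
    "\<And>s. Re s > 1 \<Longrightarrow> (g1 has_field_derivative g1 s * H1' s) (at s)"
    by (rule dirichlet_log_derivative[of "\<lambda>_. 1"]) auto
  have chi: "norm (of_int (chi8 n) :: complex) \<le> 1" for n
    using abs_chi8_le[of n] by (simp add: chi8_def)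
  obtain g2 H2 H2' where 2:
    "\<And>s. Re s > 1 \<Longrightarrow> (\<lambda>n. of_int (chi8 n) * of_nat n powr (- s)) sums g2 s"
    "\<And>s. Re s > 1 \<Longrightarrow> (\<lambda>n. of_int (chi8 n) * of_real (mangoldt n / ln (real n)) * of_nat n powr (- s)) sums H2 s"
    "\<And>s. Re s > 1 \<Longrightarrow> (\<lambda>n. of_int (chi8 n) * mangoldt n * of_nat n powr (- s)) sums (- H2' s)"
    "\<And>s. Re s > 1 \<Longrightarrow> (H2 has_field_derivative H2' s) (at s)"
    "\<And>s. Re s > 1 \<Longrightarrow> (g2 has_field_derivative g2 s * H2' s) (at s)"
    by (rule dirichlet_log_derivative[of "\<lambda>n. of_int (chi8 n)"]) (use chi in \<open>auto simp: chi8_mult\<close>)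
  define G where "G s = H1 s + H2 s" for s
  define G' where "G' s = H1' s + H2' s" for s
  have dG: "(G has_field_derivative G' s) (at s)" if "Re s > 1" for s
    unfolding G_def[abs_def] G'_def using that by (intro DERIV_add 1 2)
  \<comment> \<open>The constant is in fact \<open>1\<close>, but only \<open>c \<noteq> 0\<close> matters, and this follows from \<open>D 1 \<noteq> 0\<close>.\<close>
  have "\<exists>c. \<forall>s\<in>{s. Re s > 1}. g1 s * g2 s * exp (- G s) = c"
  proof (rule has_field_derivative_zero_constant)
    show "convex {s. Re s > 1}" by (rule convex_halfspace_Re_gt)
    fix s :: complex assume "s \<in> {s. Re s > 1}"
    then have s: "Re s > 1" by simp
    show "((\<lambda>s. g1 s * g2 s * exp (- G s)) has_field_derivative 0) (at s within {s. Re s > 1})"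
      by (rule derivative_eq_intros has_field_derivative_at_within[OF 1(5)[OF s]]
          has_field_derivative_at_within[OF 2(5)[OF s]] has_field_derivative_at_within[OF dG[OF s]] refl)+
         (simp add: G'_def algebra_simps)
  qed
  then obtain c where c: "\<And>s. Re s > 1 \<Longrightarrow> g1 s * g2 s * exp (- G s) = c" by auto
  define D where "D s = Z s * L s" for s
  have D: "D s = (s - 1) * c * exp (G s)" if s: "Re s > 1" for s
  proof -
    have "s \<noteq> 1" using s by auto
    moreover have "g1 s = Z s / (s - 1)" "g2 s = L s"
      using sums_unique2[OF 1(1)[OF s]] sums_unique2[OF 2(1)[OF s]] Z(3)[OF s] L(3)[OF s] by auto
    ultimately have "D s = (s - 1) * (g1 s * g2 s)" by (simp add: D_def)
    also have "g1 s * g2 s = c * exp (G s)"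
      using c[OF s] by (auto simp: exp_minus field_simps)
    finally show ?thesis by simp
  qed
  have hol: "D holomorphic_on {s. Re s > 0}"
    unfolding D_def by (intro holomorphic_intros Z L)
  show ?thesis
  proof (rule that[OF hol _ _ D dG])
    show D1: "D 1 \<noteq> 0" using Z L by (simp add: D_def)
    show "c \<noteq> 0"
    proof
      assume "c = 0"
      have "isCont D 1"
        using holomorphic_on_imp_continuous_on[OF hol] open_halfspace_Re_gt[of 0]
        by (auto simp: continuous_on_eq_continuous_at)
      moreover have "(\<lambda>n. 1 + complex_of_real (1 / real (Suc n))) \<longlonglongrightarrow> 1 + of_real 0"
        by (intro tendsto_intros LIMSEQ_Suc[OF lim_1_over_n])
      ultimately have "(\<lambda>n. D (1 + complex_of_real (1 / real (Suc n)))) \<longlonglongrightarrow> D 1"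
        using isCont_tendsto_compose[of 1 D] by auto
      moreover have "D (1 + complex_of_real (1 / real (Suc n))) = 0" for n
        by (subst D) (auto simp: \<open>c = 0\<close>)
      ultimately show False using D1 by (simp add: LIMSEQ_const_iff)
    qed
    fix s :: complex assume s: "Re s > 1"
    show "(\<lambda>n. of_real (mangoldt n * (1 + of_int (chi8 n)) / ln (real n)) * of_nat n powr (- s)) sums G s"
      using sums_add[OF 1(2)[OF s] 2(2)[OF s]] by (simp add: G_def algebra_simps add_divide_distrib)
    show "(\<lambda>n. of_real (mangoldt n * (1 + of_int (chi8 n))) * of_nat n powr (- s)) sums (- G' s)"
      using sums_add[OF 1(3)[OF s] 2(3)[OF s]] by (simp add: G'_def algebra_simps)
  qed
qed

section \<open>Nonvanishing on the line Re s = 1\<close>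

lemma Re_nat_powr:
  "Re (of_nat n powr (- (of_real x + \<i> * of_real t))) = real n powr (- x) * cos (t * ln (real n))"
proof (cases "n = 0")
  case False
  then have "of_nat n powr (- (of_real x + \<i> * of_real t)) = exp (- (of_real x + \<i> * of_real t) * of_real (ln (real n)))"
    by (simp add: powr_def)
  then show ?thesis using False by (simp add: Re_exp powr_def)
qed auto

text \<open>With y = t ln n each term carries the factor 3 + 4 cos y + cos 2y = 2 (1 + cos
  y)^2.\<close>

lemma mertens_inequality:
  fixes c :: "nat \<Rightarrow> real"
  assumes c: "\<And>n. c n \<ge> 0" and x: "x > 1"
    and G: "\<And>s. Re s > 1 \<Longrightarrow> (\<lambda>n. of_real (c n) * of_nat n powr (- s)) sums G s"
  shows "3 * Re (G (of_real x)) + 4 * Re (G (of_real x + \<i> * of_real t)) + Re (G (of_real x + \<i> * of_real (2 * t))) \<ge> 0"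
proof -
  have R: "(\<lambda>n. c n * (real n powr (- x) * cos (t * ln (real n)))) sums Re (G (of_real x + \<i> * of_real t))" for t
  proof -
    have "(\<lambda>n. Re (of_real (c n) * of_nat n powr (- (of_real x + \<i> * of_real t)))) sums Re (G (of_real x + \<i> * of_real t))"
      using x by (intro sums_Re G) auto
    moreover have "Re (of_real a * z) = a * Re z" for a z by simp
    ultimately show ?thesis by (simp only: Re_nat_powr)
  qed
  define w where "w n t = c n * (real n powr (- x) * cos (t * ln (real n)))" for n t
  have S: "(\<lambda>n. 3 * w n 0 + 4 * w n t + w n (2 * t)) sums
      (3 * Re (G (of_real x + \<i> * of_real 0)) + 4 * Re (G (of_real x + \<i> * of_real t)) + Re (G (of_real x + \<i> * of_real (2 * t))))"
    unfolding w_def by (intro sums_add sums_mult R)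
  have "3 * w n 0 + 4 * w n t + w n (2 * t) \<ge> 0" for n
  proof -
    define y where "y = t * ln (real n)"
    have "3 * w n 0 + 4 * w n t + w n (2 * t) = c n * real n powr (- x) * (3 + 4 * cos y + cos (2 * y))"
      by (simp add: w_def y_def algebra_simps)
    also have "3 + 4 * cos y + cos (2 * y) = 2 * (1 + cos y)\<^sup>2"
      unfolding cos_double_cos by (simp add: power2_eq_square algebra_simps)
    finally show ?thesis using c[of n] by simp
  qed
  from sums_le[OF this sums_zero S] show ?thesis by simp
qed

text \<open>The pole of the zeta function shows in |D(1 + h)| = h |c| exp(Re G(1 + h)), which enters
  to the third power; a zero at w would make D(w + h) of order h, entering to the fourth. One power
  of h is left over, against the 3-4-1 inequality.\<close>

lemma nonvanishing_on_line:
  fixes k :: "nat \<Rightarrow> real"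
  assumes hol: "D holomorphic_on {s. Re s > 0}" and "D 1 \<noteq> 0" and c: "c \<noteq> 0"
    and D: "\<And>s. Re s > 1 \<Longrightarrow> D s = (s - 1) * c * exp (G s)"
    and k: "\<And>n. k n \<ge> 0"
    and G: "\<And>s. Re s > 1 \<Longrightarrow> (\<lambda>n. of_real (k n) * of_nat n powr (- s)) sums G s"
  shows "D (1 + \<i> * of_real t) \<noteq> 0"
proof (cases "t = 0")
  case True
  then show ?thesis using assms by simp
next
  case t: False
  show ?thesis
  proof
    define w where "w = 1 + \<i> * of_real t"
    define w2 where "w2 = 1 + \<i> * of_real (2 * t)"
    assume "D (1 + \<i> * of_real t) = 0"
    then have Dw: "D w = 0" by (simp add: w_def)
    have op: "open {s::complex. Re s > 0}" by (rule open_halfspace_Re_gt)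
    have cont: "isCont D z" if "Re z > 0" for z
      using holomorphic_on_imp_continuous_on[OF hol] op that
      by (auto simp: continuous_on_eq_continuous_at)
    have of_real_lim: "filterlim complex_of_real (at 0) (at_right 0)"
      unfolding filterlim_at
      by (auto simp: eventually_at_filter intro!: tendsto_eq_intros)
    have lim: "((\<lambda>h::real. D (z + of_real h)) \<longlongrightarrow> D z) (at_right 0)" if "Re z > 0" for z
      by (rule isCont_tendsto_compose[OF cont[OF that]]) (auto intro!: tendsto_eq_intros)
    have "(D has_field_derivative deriv D w) (at w)"
      using hol op by (rule holomorphic_derivI) (simp add: w_def)
    then have "((\<lambda>h. (D (w + h) - D w) / h) \<longlongrightarrow> deriv D w) (at 0)"
      by (simp add: DERIV_def)
    from filterlim_compose[OF this of_real_lim]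
    have quot: "((\<lambda>h::real. D (w + of_real h) / of_real h) \<longlongrightarrow> deriv D w) (at_right 0)"
      using Dw by simp
    \<comment> \<open>Powers of h: h^3 is hidden in D(1 + h), h^(-4) stands in the quotient, and the
      last factor balances them. So q stays above a constant, while differentiability of D at the
      supposed zero forces q to 0.\<close>
    define q where "q h = norm (D (1 + of_real h)) ^ 3 * norm (D (w + of_real h) / of_real h) ^ 4 * norm (D (w2 + of_real h)) * h" for h :: real
    have "(q \<longlongrightarrow> norm (D 1) ^ 3 * norm (deriv D w) ^ 4 * norm (D w2) * 0) (at_right 0)"
      unfolding q_def[abs_def] by (intro tendsto_intros lim quot) (auto simp: w2_def)
    then have q0: "(q \<longlongrightarrow> 0) (at_right 0)" by simp
    \<comment> \<open>From |s - 1| \<ge> |t| at w + h and |s - 1| \<ge> |2 t| at w2 + h; the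
      constant c occurs 3 + 4 + 1 times.\<close>
    define B where "B = norm c ^ 8 * (\<bar>t\<bar> ^ 4 * \<bar>2 * t\<bar>)"
    have "B > 0" using t c by (simp add: B_def)
    have "q h \<ge> B" if h: "h > 0" for h
    proof -
      define x where "x = 1 + h"
      have x: "x > 1" using h by (simp add: x_def)
      define e0 e1 e2 where "e0 = exp (Re (G (of_real x)))" "e1 = exp (Re (G (of_real x + \<i> * of_real t)))"
        "e2 = exp (Re (G (of_real x + \<i> * of_real (2 * t))))"
      note e_def = this
      have e: "e0 > 0" "e1 > 0" "e2 > 0" by (simp_all add: e_def)
      have eq: "1 + of_real h = complex_of_real x" "w + of_real h = of_real x + \<i> * of_real t"
        "w2 + of_real h = of_real x + \<i> * of_real (2 * t)"
        by (simp_all add: x_def w_def w2_def)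
      have n0: "norm (D (1 + of_real h)) = h * norm c * e0"
        unfolding eq using x h by (subst D) (auto simp: norm_mult e_def x_def)
      have "norm (D (w + of_real h)) = norm (of_real x + \<i> * of_real t - 1) * norm c * e1"
        unfolding eq using x by (subst D) (auto simp: norm_mult e_def)
      moreover have "norm (of_real x + \<i> * of_real t - 1) \<ge> \<bar>t\<bar>"
        using abs_Im_le_cmod[of "of_real x + \<i> * of_real t - 1"] by simp
      ultimately have n1: "norm (D (w + of_real h)) \<ge> \<bar>t\<bar> * norm c * e1"
        using e by (simp add: mult_right_mono)
      have "norm (D (w2 + of_real h)) = norm (of_real x + \<i> * of_real (2 * t) - 1) * norm c * e2"
        unfolding eq using x by (subst D) (auto simp: norm_mult e_def)
      moreover have "norm (of_real x + \<i> * of_real (2 * t) - 1) \<ge> \<bar>2 * t\<bar>"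
        using abs_Im_le_cmod[of "of_real x + \<i> * of_real (2 * t) - 1"] by simp
      ultimately have n2: "norm (D (w2 + of_real h)) \<ge> \<bar>2 * t\<bar> * norm c * e2"
        using e by (simp add: mult_right_mono)
      have "e0 ^ 3 * e1 ^ 4 * e2 = exp (3 * Re (G (of_real x)) + 4 * Re (G (of_real x + \<i> * of_real t)) + Re (G (of_real x + \<i> * of_real (2 * t))))"
        by (simp add: e_def exp_add flip: exp_of_nat_mult)
      also have "\<dots> \<ge> 1"
        using mertens_inequality[OF k x G, of t] by simp
      finally have e1: "e0 ^ 3 * e1 ^ 4 * e2 \<ge> 1" .
      have "B * 1 \<le> B * (e0 ^ 3 * e1 ^ 4 * e2)"
        using e1 \<open>B > 0\<close> by (intro mult_left_mono) auto
      also have "\<dots> = (h * norm c * e0) ^ 3 * ((\<bar>t\<bar> * norm c * e1) / h) ^ 4 * (\<bar>2 * t\<bar> * norm c * e2) * h"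
        using h by (simp add: B_def field_simps eval_nat_numeral)
      also have "\<dots> \<le> q h"
        unfolding q_def n0 using h e n1 n2
        by (intro mult_mono mult_right_mono mult_left_mono power_mono) (auto simp: norm_divide intro!: divide_right_mono mult_nonneg_nonneg)
      finally show ?thesis by simp
    qed
    then have "\<forall>\<^sub>F h in at_right 0. B \<le> q h"
      by (auto simp: eventually_at_filter)
    from tendsto_lowerbound[OF q0 this] \<open>B > 0\<close> show False by simp
  qed
qed

section \<open>Newman's theorem applied to the prime ideals\<close>

text \<open>Chebyshev's function of \<rat>(\<surd>2): powers of prime ideals counted by norm,
  weighted by the logarithm of the norm of the prime. The factor 1 + \<chi>(k) is 2 at powers of
  split primes and 1 at powers of 2; for inert primes it is 0 at odd powers and 2 at even
  ones.\<close>

definition psiK :: "nat \<Rightarrow> real" where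
  "psiK n = (\<Sum>k\<le>n. mangoldt k * (1 + of_int (chi8 k)))"

text \<open>Summation by parts turns the series of \<open>psiK n / n\<close> into (h(s+1) - G'(s)) /
  s, with h(s+1) holomorphic for Re s > 0 and G' = D'/D - 1/(s-1). On the closed half-plane the only
  pole is at 1, and subtracting \<zeta> removes it.\<close>

lemma summable_psiK:
  assumes C: "\<And>n. psiK n \<le> C * real n"
  shows "summable (\<lambda>n. (psiK n / real n - 1) / real n)"
proof -
  obtain Z where Z: "Z holomorphic_on {s. Re s > 0}" "Z 1 = 1"
    "\<And>s. Re s > 1 \<Longrightarrow> (\<lambda>n. of_nat n powr (- s)) sums (Z s / (s - 1))"
    using zeta_continuation by blast
  obtain D c G G' where D: "D holomorphic_on {s. Re s > 0}" "D 1 \<noteq> 0" "c \<noteq> 0"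
    "\<And>s. Re s > 1 \<Longrightarrow> D s = (s - 1) * c * exp (G s)"
    and G: "\<And>s. Re s > 1 \<Longrightarrow> (G has_field_derivative G' s) (at s)"
    "\<And>s. Re s > 1 \<Longrightarrow> (\<lambda>n. of_real (mangoldt n * (1 + of_int (chi8 n)) / ln (real n)) * of_nat n powr (- s)) sums G s"
    "\<And>s. Re s > 1 \<Longrightarrow> (\<lambda>n. of_real (mangoldt n * (1 + of_int (chi8 n))) * of_nat n powr (- s)) sums (- G' s)"
  proof (rule zetaK_continuation, goal_cases)
    case (1 D c G G')
    from 1(2-8) show ?case by (rule 1(1))
  qed
  have nonneg: "mangoldt n * (1 + real_of_int (chi8 n)) \<ge> 0" for n
    by (auto simp: chi8_def mangoldt_nonneg)
  have op: "open {s::complex. Re s > 0}" by (rule open_halfspace_Re_gt)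
  have psi0: "psiK n \<ge> 0" for n unfolding psiK_def by (intro sum_nonneg nonneg)
  have kn: "mangoldt n * (1 + real_of_int (chi8 n)) / ln (real n) \<ge> 0" for n
    using nonneg[of n] by (cases "n = 0") auto
  have line: "D (1 + \<i> * of_real t) \<noteq> 0" for t
    by (rule nonvanishing_on_line[OF D kn G(2)])
  define U where "U = {s. Re s > 0 \<and> D s \<noteq> 0}"
  have U: "open U"
  proof -
    have "open ({s. Re s > 0} \<inter> D -` (- {0}))"
      by (rule continuous_open_preimage[OF holomorphic_on_imp_continuous_on[OF D(1)] op]) auto
    moreover have "{s. Re s > 0} \<inter> D -` (- {0}) = U" by (auto simp: U_def)
    ultimately show ?thesis by simp
  qed
  have gt1U: "s \<in> U" if "Re s > 1" for s
  proof -
    have "s \<noteq> 1" using that by auto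
    then show ?thesis using that D by (simp add: U_def)
  qed
  have U1: "{s. Re s \<ge> 1} \<subseteq> U"
  proof safe
    fix s assume "Re s \<ge> 1"
    show "s \<in> U"
    proof (cases "Re s = 1")
      case True
      then have "s = 1 + \<i> * of_real (Im s)" by (simp add: complex_eq_iff)
      then have "D s \<noteq> 0" using line[of "Im s"] by simp
      then show ?thesis using True by (simp add: U_def)
    next
      case False
      then show ?thesis using \<open>Re s \<ge> 1\<close> gt1U by auto
    qed
  qed
  define C1 where "C1 = max C 0"
  have C1: "\<bar>psiK n / real n\<bar> \<le> C1" for n
  proof (cases "n = 0")
    case False
    have "psiK n \<le> C1 * real n"
      using C[of n] mult_right_mono[of C C1 "real n"] by (simp add: C1_def)
    then show ?thesis using psi0[of n] False by (simp add: field_simps)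
  qed (simp add: C1_def)
  obtain g1 g1' where g1: "\<And>s. Re s > 1 \<Longrightarrow> (\<lambda>n. of_real (psiK n / real n) * of_nat n powr (- s)) sums g1 s"
    and "\<And>s. Re s > 1 \<Longrightarrow> (\<lambda>n. - (of_real (psiK n / real n) * of_real (ln (real n)) * of_nat n powr (- s))) sums g1' s"
    and "\<And>s. Re s > 1 \<Longrightarrow> (g1 has_field_derivative g1' s) (at s)"
  proof (rule dirichlet_series_converges[of "\<lambda>n. of_real (psiK n / real n)" C1], goal_cases)
    case (1 n)
    then show ?case by (simp only: norm_of_real C1)
  next
    case (2 g g')
    from 2(2-4) show ?case by (rule 2(1))
  qed
  obtain h where h: "\<And>s. Re s > 1 \<Longrightarrow> (\<lambda>n. of_real (psiK n) * powr_remainder n s) sums h s"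
    "h holomorphic_on {s. Re s > 1}"
  proof (rule remainder_series_converges[of "\<lambda>n. of_real (psiK n)" C1 1])
    show "cmod (of_real (psiK n)) \<le> C1 * real n powr 1" if "n > 0" for n
      using C1[of n] psi0[of n] that by (simp add: field_simps)
  qed (use that in auto)
  \<comment> \<open>The polar parts are 1/(s (s - 1)), coming from -G'/s, and Z(s)/(s - 1) =
    \<zeta>(s). They differ by W(s)/(s - 1), and as W vanishes at 1 this extends holomorphically to
    E.\<close>
  define W where "W s = 1 / s - Z s" for s
  define E where "E s = (if s = 1 then deriv W 1 else (W s - W 1) / (s - 1))" for s
  have W: "W holomorphic_on {s. Re s > 0}"
    unfolding W_def by (intro holomorphic_intros Z) auto
  have E: "E holomorphic_on {s. Re s > 0}"
    unfolding E_def using W op by (rule pole_lemma_open)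
  have W1: "W 1 = 0" by (simp add: W_def Z)
  define F where "F s = - deriv D s / (D s * s) + h (s + 1) / s + E s" for s
  have F: "F holomorphic_on U"
  proof -
    have "(\<lambda>s. h (s + 1)) holomorphic_on {s. Re s > 0}"
      by (rule holomorphic_on_compose_gen[unfolded o_def, OF _ h(2)]) (auto intro!: holomorphic_intros)
    moreover have "U \<subseteq> {s. Re s > 0}" by (auto simp: U_def)
    ultimately have "(\<lambda>s. h (s + 1)) holomorphic_on U" "D holomorphic_on U" "E holomorphic_on U"
      using D(1) E by (auto elim: holomorphic_on_subset)
    then show ?thesis unfolding F_def
      using U by (intro holomorphic_intros holomorphic_deriv) (auto simp: U_def)
  qed
  have sums: "(\<lambda>n. of_real (psiK n / real n - 1) * of_nat n powr (- s)) sums F s" if s: "Re s > 1" for s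
  proof -
    have s0: "s \<noteq> 0" "s \<noteq> 1" using s by auto
    have "(\<lambda>n. of_real (mangoldt n * (1 + of_int (chi8 n))) * of_nat n powr (- s)) sums (s * g1 s - h (s + 1))"
    proof (rule sums_by_parts)
      have eq: "(\<Sum>k\<le>n. of_real (mangoldt k * (1 + of_int (chi8 k)))) = complex_of_real (psiK n)" for n
        by (simp add: psiK_def)
      show "cmod (\<Sum>k\<le>n. of_real (mangoldt k * (1 + of_int (chi8 k)))) \<le> C * real n" for n
        unfolding eq using C[of n] psi0[of n] by simp
      show "(\<lambda>n. (\<Sum>k\<le>n. of_real (mangoldt k * (1 + of_int (chi8 k)))) * powr_remainder n (s + 1)) sums h (s + 1)"
        unfolding eq using s by (intro h) auto
      have "of_real (psiK n) * of_nat n powr - (s + 1) = of_real (psiK n / real n) * of_nat n powr (- s)" for n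
        by (cases "n = 0") (auto simp: powr_diff)
      then show "(\<lambda>n. (\<Sum>k\<le>n. of_real (mangoldt k * (1 + of_int (chi8 k)))) * of_nat n powr - (s + 1)) sums g1 s"
        unfolding eq using g1[OF s] by simp
    qed (use s in auto)
    then have G': "- G' s = s * g1 s - h (s + 1)"
      using G(3)[OF s] sums_unique2 by blast
    have "(D has_field_derivative (c * exp (G s) + (s - 1) * c * (exp (G s) * G' s))) (at s)"
    proof (rule has_field_derivative_transform_within_open)
      show "((\<lambda>s. (s - 1) * c * exp (G s)) has_field_derivative (c * exp (G s) + (s - 1) * c * (exp (G s) * G' s))) (at s)"
        by (rule derivative_eq_intros G(1)[OF s] refl)+ (simp add: algebra_simps)
      show "open {s. Re s > 1}" by (rule open_halfspace_Re_gt)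
    qed (use s D(4) in auto)
    then have "deriv D s = c * exp (G s) + (s - 1) * c * (exp (G s) * G' s)"
      by (rule DERIV_imp_deriv)
    also have "\<dots> = (1 / (s - 1) + G' s) * ((s - 1) * c * exp (G s))"
    proof -
      have "s - 1 \<noteq> 0" using s0 by simp
      then have "1 / (s - 1) * ((s - 1) * c * exp (G s)) = c * exp (G s)" by simp
      then show ?thesis by (simp only: distrib_right) (simp add: mult_ac)
    qed
    finally have dD: "deriv D s / D s = 1 / (s - 1) + G' s"
      using s0 D(3) by (simp add: D(4)[OF s])
    have Es: "E s = (1 / s - Z s) / (s - 1)"
      using s0 W1 by (simp add: E_def) (simp add: W_def)
    have "F s = - (deriv D s / D s) / s + h (s + 1) / s + (1 / s - Z s) / (s - 1)"
      by (simp add: F_def Es)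
    also have "\<dots> = (- G' s + h (s + 1)) / s - (1 / (s - 1)) / s + (1 / s - Z s) / (s - 1)"
      unfolding dD using s0 by (simp add: field_simps)
    also have "\<dots> = g1 s - Z s / (s - 1)"
    proof -
      have "(s * g1 s - h (s + 1) + h (s + 1)) / s = g1 s" using s0 by simp
      moreover have "(1 / s - Z s) / (s - 1) = (1 / (s - 1)) / s - Z s / (s - 1)"
        by (simp add: diff_divide_distrib mult.commute)
      ultimately show ?thesis unfolding G' by simp
    qed
    finally have Fs: "F s = g1 s - Z s / (s - 1)" .
    show ?thesis
      unfolding Fs using sums_diff[OF g1[OF s] Z(3)[OF s]] by (simp add: left_diff_distrib)
  qed
  have "(\<lambda>n. of_real (psiK n / real n - 1) / of_nat n) sums F 1"
  proof (rule Newman_Tauberian[OF _ U U1 F sums])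
    show "cmod (of_real (psiK n / real n - 1)) \<le> C1 + 1" for n
      unfolding norm_of_real using C1[of n] by linarith
  qed
  then have "summable (\<lambda>n. Re (of_real (psiK n / real n - 1) / of_nat n))"
    by (intro summable_Re) (simp add: sums_iff)
  moreover have "Re (of_real (psiK n / real n - 1) / of_nat n) = (psiK n / real n - 1) / real n" for n
    by (metis Re_complex_of_real of_real_divide of_real_of_nat_eq)
  ultimately show ?thesis by simp
qed

section \<open>Chebyshev bounds\<close>

lemma card_multiples_upto:
  fixes n d :: nat
  assumes "d > 0"
  shows "card {m \<in> {1..n}. d dvd m} = n div d"
proof -
  have "{m \<in> {1..n}. d dvd m} = (\<lambda>k. d * k) ` {1..n div d}"
    using assms by (auto simp: image_iff dvd_def less_eq_div_iff_mult_less_eq mult.commute Suc_le_eq)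
  then show ?thesis using assms by (simp add: card_image inj_on_def)
qed

text \<open>Legendre's formula, by interchanging the sums over m and over divisors of m. Indices
  between n and N contribute 0; the common range lets n! and (2n)! be compared term by term.\<close>

lemma ln_fact_eq_sum_mangoldt:
  assumes "n \<le> N"
  shows "ln (fact n) = (\<Sum>d=1..N. mangoldt d * real (n div d))"
proof -
  have "ln (fact n :: real) = (\<Sum>m=1..n. ln (real m))"
    unfolding fact_prod of_nat_prod by (rule ln_prod) auto
  also have "\<dots> = (\<Sum>m=1..n. \<Sum>d | d dvd m. mangoldt d)"
    by (intro sum.cong) (simp_all add: mangoldt_sum)
  also have "\<dots> = (\<Sum>m=1..n. \<Sum>d=1..N. if d dvd m then mangoldt d else 0)"
  proof (rule sum.cong)
    fix m assume m: "m \<in> {1..n}"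
    have "d \<in> {1..N}" if "d dvd m" for d
      using that m assms dvd_imp_le[of d m] by (cases "d = 0") auto
    then show "(\<Sum>d | d dvd m. mangoldt d) = (\<Sum>d=1..N. if d dvd m then mangoldt d else 0 :: real)"
      by (intro sum.mono_neutral_cong_left) auto
  qed simp
  also have "\<dots> = (\<Sum>d=1..N. \<Sum>m=1..n. if d dvd m then mangoldt d else 0)"
    by (rule sum.swap)
  also have "\<dots> = (\<Sum>d=1..N. mangoldt d * real (n div d))"
  proof (rule sum.cong)
    fix d assume "d \<in> {1..N}"
    then have "(\<Sum>m=1..n. if d dvd m then mangoldt d else 0) = real (card {m \<in> {1..n}. d dvd m}) * mangoldt d"
      by (subst sum.inter_filter[symmetric]) auto
    also have "card {m \<in> {1..n}. d dvd m} = n div d"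
      using \<open>d \<in> _\<close> by (intro card_multiples_upto) auto
    finally show "(\<Sum>m=1..n. if d dvd m then mangoldt d else 0) = mangoldt d * real (n div d)"
      by (simp add: mult.commute)
  qed simp
  finally show ?thesis .
qed

definition psi :: "nat \<Rightarrow> real" where "psi n = (\<Sum>k\<le>n. mangoldt k)"

lemma psi_mono: "m \<le> n \<Longrightarrow> psi m \<le> psi n"
  unfolding psi_def by (intro sum_mono2) (auto simp: mangoldt_nonneg)

text \<open>Chebyshev's argument with the central binomial coefficient: floor(2n/d) - 2 floor(n/d)
  is never negative and equals 1 for n < d \<le> 2n, so the weights in that range sum to at most ln
  (2n choose n).\<close>

lemma psi_double_le: "psi (2 * n) \<le> psi n + 2 * real n * ln 2"
proof -
  have "psi (2 * n) = psi n + (\<Sum>d\<in>{n<..2 * n}. mangoldt d)"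
    unfolding psi_def by (subst sum.union_disjoint[symmetric]) (auto intro!: sum.cong)
  also have "(\<Sum>d\<in>{n<..2 * n}. mangoldt d) =
      (\<Sum>d\<in>{n<..2 * n}. mangoldt d * (real (2 * n div d) - 2 * real (n div d)) :: real)"
  proof (rule sum.cong)
    fix d assume d: "d \<in> {n<..2 * n}"
    then have "2 * n div d = 1" by (intro div_nat_eqI) auto
    then show "mangoldt d = mangoldt d * (real (2 * n div d) - 2 * real (n div d))" using d by simp
  qed simp
  also have "\<dots> \<le> (\<Sum>d=1..2 * n. mangoldt d * (real (2 * n div d) - 2 * real (n div d)))"
  proof (rule sum_mono2)
    fix d
    have "d * (2 * (n div d)) \<le> 2 * n" by simp
    then have "2 * (n div d) \<le> 2 * n div d" if "d > 0"
      using that by (simp add: less_eq_div_iff_mult_less_eq mult_ac)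
    then have "2 * real (n div d) \<le> real (2 * n div d)"
      by (cases "d = 0") (auto simp flip: of_nat_mult)
    then show "0 \<le> mangoldt d * (real (2 * n div d) - 2 * real (n div d))"
      by (simp add: mangoldt_nonneg)
  qed auto
  also have "\<dots> = ln (fact (2 * n)) - 2 * ln (fact n)"
    using ln_fact_eq_sum_mangoldt[of "2 * n" "2 * n"] ln_fact_eq_sum_mangoldt[of n "2 * n"]
    by (simp add: sum_subtractf sum_distrib_left algebra_simps)
  also have "\<dots> = ln (real (2 * n choose n))"
  proof -
    have "real (2 * n choose n) = fact (2 * n) / (fact n * fact n)"
      using binomial_fact[of n "2 * n", where 'a = real] by simp
    then show ?thesis by (simp add: ln_div ln_mult)
  qed
  also have "\<dots> \<le> ln (2 ^ (2 * n))"
  proof -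
    have "2 * n choose n \<le> 2 ^ (2 * n)" by (rule binomial_le_pow2)
    then have "real (2 * n choose n) \<le> 2 ^ (2 * n)" by (metis of_nat_le_iff of_nat_numeral of_nat_power)
    then show ?thesis by (subst ln_le_cancel_iff) auto
  qed
  also have "\<dots> = 2 * real n * ln 2" by (subst ln_realpow) auto
  finally show ?thesis by simp
qed

text \<open>Doubling gives 2^(k+1) ln 2 at powers of two; passing from n to the next power of two
  costs another factor 2, and ln 2 < 1.\<close>

lemma psi_le: "psi n \<le> 4 * real n"
proof (cases "n = 0")
  case False
  have pow: "psi (2 ^ k) \<le> 2 * 2 ^ k * ln 2" for k
  proof (induction k)
    case 0
    then show ?case by (simp add: psi_def)
  next
    case (Suc k)
    then show ?case using psi_double_le[of "2 ^ k"] by simp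
  qed
  define k where "k = floor_log n"
  have "2 ^ k \<le> n" "n < 2 * 2 ^ k"
    using False floor_log_exp2_le[of n] floor_log_exp2_gt[of n] by (auto simp: k_def)
  then have "psi n \<le> psi (2 ^ Suc k)" by (intro psi_mono) auto
  also have "\<dots> \<le> (4 * 2 ^ k) * ln 2" using pow[of "Suc k"] by simp
  also have "\<dots> \<le> (4 * 2 ^ k) * 1" using ln_2_less_1 by (intro mult_left_mono) auto
  also have "\<dots> \<le> 4 * real n"
    using \<open>2 ^ k \<le> n\<close> by (metis mult.right_neutral mult_left_mono of_nat_le_iff of_nat_numeral of_nat_power zero_le_numeral)
  finally show ?thesis .
qed (simp add: psi_def)

section \<open>From summable deviations to the limit\<close>

text \<open>If f(n) \<ge> (1 + 2e) n, monotonicity keeps f(m) - m above e n for m up to (1 + e) n.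
  At least e n / 2 consecutive terms, each at least e/(4n), then sum to e^2/8 or more, against the
  Cauchy criterion. A deficit at n persists to the left in the same way.\<close>

lemma tendsto_if_summable_deviation:
  fixes f :: "nat \<Rightarrow> real"
  assumes mono: "\<And>m n. m \<le> n \<Longrightarrow> f m \<le> f n"
    and summable: "summable (\<lambda>n. (f n / real n - 1) / real n)"
  shows "(\<lambda>n. f n / real n) \<longlonglongrightarrow> 1"
proof (rule tendstoI)
  fix e' :: real assume e': "e' > 0"
  \<comment> \<open>The cap 1/4 keeps m below 2 n to the right, and to the left keeps the block
    above n / 2, hence above N.\<close>
  define e where "e = min (e' / 2) (1 / 4)"
  have e: "e > 0" "e \<le> 1 / 4" "2 * e \<le> e'" using e' by (auto simp: e_def min_def)
  define t where "t n = (f n / real n - 1) / real n" for n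
  obtain N where N: "\<And>m n. m \<ge> N \<Longrightarrow> norm (sum t {m..<n}) < e\<^sup>2 / 8"
    using summable[unfolded summable_Cauchy] e unfolding t_def[symmetric]
    by (metis divide_pos_pos zero_less_numeral zero_less_power)
  have main: "\<bar>f n / real n - 1\<bar> < 2 * e" if n: "n \<ge> 2 * N + 1" "real n \<ge> 2 / e" for n
  proof -
    have n0: "real n > 0" using n by simp
    \<comment> \<open>The block length; because e n \<ge> 2, rounding down loses at most half of
      it.\<close>
    define j where "j = nat \<lfloor>e * real n\<rfloor>"
    have en: "e * real n \<ge> 2" using n e by (simp add: field_simps)
    have j: "real j \<le> e * real n" "real j \<ge> e * real n / 2"
      using en unfolding j_def by linarith+
    have "f n / real n < 1 + 2 * e"
    proof (rule ccontr)
      assume "\<not> ?thesis"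
      then have fn: "f n \<ge> (1 + 2 * e) * real n" using n0 by (simp add: field_simps)
      have "e / (4 * real n) \<le> t m" if m: "m \<in> {n..<n + j}" for m
      proof -
        have m0: "real m > 0" using m n0 by auto
        have "real m \<le> real n + real j" using m by auto
        then have m1: "real m \<le> (1 + e) * real n" using j by (simp add: algebra_simps)
        then have m2: "real m \<le> 2 * real n" using e n0 mult_right_mono[of "1 + e" 2 "real n"] by linarith
        have "(1 + 2 * e) * real n \<le> f m" using fn mono[of n m] m by auto
        then have "e * real n \<le> f m - real m" using m1 by (simp add: algebra_simps)
        then have "e * real n / (real m)\<^sup>2 \<le> t m"
          using m0 by (simp add: t_def field_simps power2_eq_square)
        moreover have "e * real n / (2 * real n)\<^sup>2 \<le> e * real n / (real m)\<^sup>2"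
          using m2 m0 n0 e by (intro divide_left_mono power_mono mult_pos_pos) auto
        moreover have "e * real n / (2 * real n)\<^sup>2 = e / (4 * real n)"
          using n0 by (simp add: field_simps power2_eq_square)
        ultimately show ?thesis by linarith
      qed
      then have "real (card {n..<n + j}) * (e / (4 * real n)) \<le> sum t {n..<n + j}"
        by (intro sum_bounded_below)
      moreover have "e * real n / 2 * (e / (4 * real n)) \<le> real j * (e / (4 * real n))"
        using j e n0 by (intro mult_right_mono) auto
      moreover have "e * real n / 2 * (e / (4 * real n)) = e\<^sup>2 / 8"
        using n0 by (simp add: field_simps power2_eq_square)
      ultimately have "e\<^sup>2 / 8 \<le> sum t {n..<n + j}" by simp
      then show False using N[of n "n + j"] n by simp
    qed
    moreover have "f n / real n > 1 - 2 * e"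
    proof (rule ccontr)
      assume "\<not> ?thesis"
      then have fn: "f n \<le> (1 - 2 * e) * real n" using n0 by (simp add: field_simps)
      have jn: "2 * real j \<le> real n" using j e n0 mult_right_mono[of e "1 / 4" "real n"] by linarith
      then have jn': "j \<le> n" "n - j \<ge> N" using n by linarith+
      have "e / (4 * real n) \<le> - t m" if m: "m \<in> {n - j..<n}" for m
      proof -
        have "real m \<ge> real n - real j" using m by auto
        then have m1: "real m \<ge> (1 - e) * real n" using j by (simp add: algebra_simps)
        have m0: "real m > 0" using \<open>real m \<ge> real n - real j\<close> jn n0 by linarith
        have m2: "real m \<le> 2 * real n" using m by auto
        have "f m \<le> (1 - 2 * e) * real n" using fn mono[of m n] m by auto
        then have "e * real n \<le> real m - f m" using m1 by (simp add: algebra_simps)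
        then have "e * real n / (real m)\<^sup>2 \<le> - t m"
          using m0 by (simp add: t_def field_simps power2_eq_square)
        moreover have "e * real n / (2 * real n)\<^sup>2 \<le> e * real n / (real m)\<^sup>2"
          using m2 m0 n0 e by (intro divide_left_mono power_mono mult_pos_pos) auto
        moreover have "e * real n / (2 * real n)\<^sup>2 = e / (4 * real n)"
          using n0 by (simp add: field_simps power2_eq_square)
        ultimately show ?thesis by linarith
      qed
      then have "real (card {n - j..<n}) * (e / (4 * real n)) \<le> (\<Sum>m\<in>{n - j..<n}. - t m)"
        by (intro sum_bounded_below)
      moreover have "e * real n / 2 * (e / (4 * real n)) \<le> real j * (e / (4 * real n))"
        using j e n0 by (intro mult_right_mono) auto
      moreover have "e * real n / 2 * (e / (4 * real n)) = e\<^sup>2 / 8"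
        using n0 by (simp add: field_simps power2_eq_square)
      ultimately have "e\<^sup>2 / 8 \<le> - sum t {n - j..<n}" using jn' by (simp add: sum_negf)
      then show False using N[of "n - j" n] jn' by simp
    qed
    ultimately show ?thesis by (simp add: abs_less_iff)
  qed
  have "\<forall>\<^sub>F n in sequentially. n \<ge> 2 * N + 1 \<and> real n \<ge> 2 / e"
    using eventually_ge_at_top[of "max (2 * N + 1) (nat \<lceil>2 / e\<rceil>)"] by eventually_elim linarith
  then show "\<forall>\<^sub>F n in sequentially. dist (f n / real n) 1 < e'"
    by eventually_elim (use main e in \<open>force simp: dist_real_def\<close>)
qed

text \<open>An exponent of at least 2 forces p \<le> \<surd>n, and p \<ge> 2 bounds the exponent by
  the binary logarithm. Counting the whole box of pairs is crude but far below n / ln n.\<close>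

lemma card_proper_prime_powers_le:
  assumes "n > 0"
  shows "real (card {k. k \<le> n \<and> primepow k \<and> \<not> prime k}) \<le> (sqrt (real n) + 1) * (log 2 (real n) + 1)"
proof -
  define A where "A = {..nat \<lfloor>sqrt (real n)\<rfloor>}"
  define B where "B = {..nat \<lfloor>log 2 (real n)\<rfloor>}"
  have "{k. k \<le> n \<and> primepow k \<and> \<not> prime k} \<subseteq> (\<lambda>(p, e). p ^ e) ` (A \<times> B)"
  proof
    fix k assume "k \<in> {k. k \<le> n \<and> primepow k \<and> \<not> prime k}"
    then obtain p e where k: "p ^ e \<le> n" "prime p" "e > 0" "k = p ^ e" "\<not> prime (p ^ e)"
      by (auto simp: primepow_def)
    then have "e \<ge> 2" by (cases "e = 1") auto
    have p2: "p \<ge> 2" using k prime_ge_2_nat by blast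
    have "p ^ 2 \<le> p ^ e" using \<open>e \<ge> 2\<close> p2 by (intro power_increasing) auto
    then have "p ^ 2 \<le> n" using k by linarith
    then have "real p \<le> sqrt (real n)" by (metis of_nat_le_iff of_nat_power real_le_rsqrt)
    then have "p \<in> A" by (auto simp: A_def intro: le_nat_floor)
    have "2 ^ e \<le> p ^ e" using p2 by (rule power_mono) simp
    then have "2 ^ e \<le> n" using k by linarith
    then have "real e \<le> log 2 (real n)" using assms
      by (metis le_log_of_power of_nat_le_iff of_nat_numeral of_nat_power one_less_numeral_iff semiring_norm(76))
    then have "e \<in> B" by (auto simp: B_def intro: le_nat_floor)
    then show "k \<in> (\<lambda>(p, e). p ^ e) ` (A \<times> B)" using k \<open>p \<in> A\<close> by force
  qed
  then have "card {k. k \<le> n \<and> primepow k \<and> \<not> prime k} \<le> card (A \<times> B)"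
    by (rule surj_card_le[rotated]) (simp add: A_def B_def)
  then have "real (card {k. k \<le> n \<and> primepow k \<and> \<not> prime k}) \<le> real (card A) * real (card B)"
    by (simp add: card_cartesian_product flip: of_nat_mult)
  also have "\<dots> \<le> (sqrt (real n) + 1) * (log 2 (real n) + 1)"
    using assms by (intro mult_mono) (auto simp: A_def B_def add_nonneg_nonneg)
  finally show ?thesis .
qed

section \<open>Norms of primes\<close>

text \<open>Gauss's lemma with h = (p - 1)/2: the doubles 2, ..., 2h are already reduced modulo p,
  and those exceeding h come from x > h/2. Their number h - h div 2 is even for h = 4k and h = 4k +
  3.\<close>

lemma two_quadratic_residue:
  fixes p :: nat
  assumes p: "prime p" and mod8: "p mod 8 = 1 \<or> p mod 8 = 7"
  obtains x :: int where "[x\<^sup>2 = 2] (mod int p)"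
proof -
  have "p \<noteq> 2" using mod8 by auto
  then have p2: "p > 2" using prime_ge_2_nat[OF p] by linarith
  then have "[2 \<noteq> 0] (mod int p)" by (auto simp: cong_def)
  interpret G: GAUSS p 2
    using p p2 \<open>[2 \<noteq> 0] (mod int p)\<close> by unfold_locales auto
  define h where "h = (int p - 1) div 2"
  have ph: "int p = 2 * h + 1" using G.p_eq2 by (simp add: h_def)
  have h0: "h \<ge> 0" using p2 by (simp add: h_def)
  have C: "G.C = (\<lambda>x. x * 2) ` {0<..h}"
  proof -
    have "G.C = (\<lambda>x. (x * 2) mod int p) ` {0<..h}"
      by (simp add: G.C_def G.B_def G.A_def h_def image_image)
    also have "\<dots> = (\<lambda>x. x * 2) ` {0<..h}"
      by (intro image_cong) (auto simp: ph)
    finally show ?thesis .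
  qed
  have "G.E = (\<lambda>x. x * 2) ` {h div 2<..h}"
    unfolding G.E_def C h_def[symmetric] using h0 by (auto simp: image_iff)
  then have "card G.E = card {h div 2<..h}"
    by (simp add: card_image inj_on_def)
  also have "\<dots> = nat (h - h div 2)" by simp
  finally have E: "card G.E = nat (h - h div 2)" .
  have "even (card G.E)"
  proof -
    from mod8 obtain k where "p = 8 * k + 1 \<or> p = 8 * k + 7"
      by (metis mult_div_mod_eq)
    then have "h = 4 * int k \<or> h = 4 * int k + 3" using ph by auto
    then have "h - h div 2 = 2 * int k \<or> h - h div 2 = 2 * (int k + 1)" by auto
    then have "nat (h - h div 2) = 2 * k \<or> nat (h - h div 2) = 2 * (k + 1)"
      by (elim disjE) (simp_all add: nat_add_distrib nat_mult_distrib)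
    then show ?thesis unfolding E by auto
  qed
  then have "Legendre 2 (int p) = 1" using G.gauss_lemma by simp
  then show ?thesis using that by (auto simp: Legendre_def QuadRes_def split: if_splits)
qed

text \<open>In the reals the norm is z times its conjugate, so the irrationality of \<surd>2 enters
  through the injectivity of the embedding.\<close>

lemma zsqrt2_norm_nonzero:
  assumes "z \<noteq> 0"
  shows "zsqrt2_norm z \<noteq> 0"
proof
  assume "zsqrt2_norm z = 0"
  then have "(rat_part z)\<^sup>2 = 2 * (sqrt_part z)\<^sup>2" by (simp add: zsqrt2_norm_def)
  then have "real_of_int ((rat_part z)\<^sup>2) = real_of_int (2 * (sqrt_part z)\<^sup>2)" by simp
  then have eq: "(real_of_int (rat_part z))\<^sup>2 = 2 * (real_of_int (sqrt_part z))\<^sup>2" by simp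
  define w where "w = ZSqrt2 (rat_part z) (- sqrt_part z)"
  have "real_of_zsqrt2 z * real_of_zsqrt2 w = (real_of_int (rat_part z))\<^sup>2 - 2 * (real_of_int (sqrt_part z))\<^sup>2"
    by (simp add: real_of_zsqrt2_def w_def algebra_simps power2_eq_square)
  then have "real_of_zsqrt2 z = real_of_zsqrt2 0 \<or> real_of_zsqrt2 w = real_of_zsqrt2 0"
    by (simp add: eq real_of_zsqrt2_hom)
  then have "z = 0 \<or> w = 0" using inj_real_of_zsqrt2 by (auto dest: injD)
  then show False using assms by (auto simp: w_def zero_zsqrt2_def zsqrt2.expand)
qed

text \<open>Thue's argument: a collision among the residues of \<open>i - x j\<close> for small \<open>i\<close>, \<open>j\<close>.\<close>

lemma norm_minus_prime:
  fixes p :: nat and x :: int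
  assumes p: "prime p" and x: "[x\<^sup>2 = 2] (mod int p)"
  obtains z where "zsqrt2_norm z = - int p"
proof -
  define m where "m = floor_sqrt p"
  have m1: "(int m)\<^sup>2 \<le> int p"
    using floor_sqrt_power2_le[of p] by (simp add: m_def flip: of_nat_power)
  \<comment> \<open>A prime is not a square; the strict inequality obtained from this is what
    excludes q = 1 below.\<close>
  have "(int m)\<^sup>2 \<noteq> int p"
  proof
    assume "(int m)\<^sup>2 = int p"
    then have "p = m\<^sup>2" by (metis of_nat_eq_iff of_nat_power)
    then show False using p by (simp add: prime_power_iff)
  qed
  with m1 have m1: "(int m)\<^sup>2 < int p" by linarith
  have m2: "p < (Suc m)\<^sup>2" by (simp add: m_def Suc_floor_sqrt_power2_gt)
  define f where "f = (\<lambda>(i::nat, j::nat). (int i - x * int j) mod int p)"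
  have "\<not> inj_on f ({..m} \<times> {..m})"
  proof
    assume "inj_on f ({..m} \<times> {..m})"
    moreover have "f ` ({..m} \<times> {..m}) \<subseteq> {0..<int p}"
      using prime_gt_0_nat[OF p] by (auto simp: f_def)
    ultimately have "card ({..m} \<times> {..m}) \<le> card {0..<int p}"
      by (intro card_inj_on_le) auto
    then show False using m2 by (simp add: power2_eq_square)
  qed
  then obtain i j k l where ijkl: "i \<le> m" "j \<le> m" "k \<le> m" "l \<le> m" "(i, j) \<noteq> (k, l)" "f (i, j) = f (k, l)"
    unfolding inj_on_def by auto
  define a where "a = int i - int k"
  define b where "b = int j - int l"
  have "[int i - x * int j = int k - x * int l] (mod int p)" using ijkl by (simp add: f_def cong_def)
  then have "int p dvd a - x * b" by (simp add: cong_iff_dvd_diff a_def b_def algebra_simps)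
  then have "int p dvd (a - x * b) * (a + x * b) + b\<^sup>2 * (x\<^sup>2 - 2)"
    using x by (intro dvd_add dvd_mult dvd_mult2) (auto simp: cong_iff_dvd_diff)
  then have dvd: "int p dvd a\<^sup>2 - 2 * b\<^sup>2" by (simp add: algebra_simps power2_eq_square)
  define z where "z = ZSqrt2 a b"
  have "z \<noteq> 0" using ijkl by (auto simp: z_def zero_zsqrt2_def a_def b_def)
  then have nz: "zsqrt2_norm z \<noteq> 0" by (rule zsqrt2_norm_nonzero)
  have N: "zsqrt2_norm z = a\<^sup>2 - 2 * b\<^sup>2" by (simp add: z_def zsqrt2_norm_def)
  from dvd obtain q where q: "a\<^sup>2 - 2 * b\<^sup>2 = int p * q" by (elim dvdE)
  have "\<bar>a\<bar> \<le> int m" "\<bar>b\<bar> \<le> int m" using ijkl by (auto simp: a_def b_def)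
  then have "a\<^sup>2 \<le> (int m)\<^sup>2" "b\<^sup>2 \<le> (int m)\<^sup>2" using abs_le_square_iff[of _ "int m"] by auto
  then have "a\<^sup>2 < int p" "b\<^sup>2 < int p" using m1 by linarith+
  \<comment> \<open>The norm lies strictly between -2p and p and is a nonzero multiple of p, so only
    -p is left. This explains the negative sign in the conclusion.\<close>
  then have "int p * q < int p * 1" "int p * (- 2) < int p * q"
    using q zero_le_power2[of a] zero_le_power2[of b] by linarith+
  then have "q < 1" "- 2 < q" by (simp_all only: mult_less_cancel_left_pos of_nat_0_less_iff prime_gt_0_nat[OF p])
  moreover have "q \<noteq> 0" using nz N q by auto
  ultimately have "q = - 1" by linarith
  then show ?thesis using that[of z] N q by simp
qed

lemma norm_unit: "zsqrt2_norm (ZSqrt2 1 1) = - 1"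
  by (simp add: zsqrt2_norm_def)

lemma norm_uminus_exists: "(\<exists>z. zsqrt2_norm z = - k) \<longleftrightarrow> (\<exists>z. zsqrt2_norm z = k)"
proof -
  have *: "\<exists>z. zsqrt2_norm z = - k" if "zsqrt2_norm w = k" for w k
    using that by (intro exI[of _ "ZSqrt2 1 1 * w"]) (simp add: zsqrt2_norm_mult norm_unit)
  show ?thesis using *[of _ k] *[of _ "- k"] by auto
qed

lemma zsqrt2_prime_if_norm_prime:
  assumes "prime \<bar>zsqrt2_norm z\<bar>"
  shows "zsqrt2_prime z"
  unfolding zsqrt2_prime_def
proof (intro conjI allI impI)
  show "z \<noteq> 0" using assms by (auto simp: zsqrt2_norm_def zero_zsqrt2_def)
  show "\<not> z dvd 1" using assms by (auto simp: zsqrt2_unit_iff_norm)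
  fix d assume "d dvd z"
  then obtain e where e: "z = d * e" by (elim dvdE)
  then have "\<bar>zsqrt2_norm z\<bar> = \<bar>zsqrt2_norm d\<bar> * \<bar>zsqrt2_norm e\<bar>"
    by (simp add: zsqrt2_norm_mult abs_mult)
  from irreducibleD[OF prime_elem_imp_irreducible[OF prime_imp_prime_elem[OF assms]] this]
  have "\<bar>zsqrt2_norm d\<bar> = 1 \<or> \<bar>zsqrt2_norm e\<bar> = 1" by simp
  then have "d dvd 1 \<or> e dvd 1" by (auto simp: zsqrt2_unit_iff_norm abs_if split: if_splits)
  then show "d dvd 1 \<or> zsqrt2_associated z d"
  proof
    assume "e dvd 1"
    then obtain u where u: "1 = e * u" by (elim dvdE)
    then have "u dvd 1" by (metis dvd_triv_right)
    moreover have "d = u * z" using u by (simp add: e mult.commute mult.left_commute flip: mult.assoc)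
    ultimately show ?thesis by (auto simp: zsqrt2_associated_def)
  qed auto
qed

lemma norm_eq_if_nonunit_dvd_prime:
  assumes "zsqrt2_prime z" "d dvd z" "\<bar>zsqrt2_norm d\<bar> \<noteq> 1"
  shows "\<bar>zsqrt2_norm d\<bar> = \<bar>zsqrt2_norm z\<bar>"
proof -
  have "\<not> d dvd 1" using assms(3) by (auto simp: zsqrt2_unit_iff_norm)
  then obtain u where "u dvd 1" "d = u * z"
    using assms by (auto simp: zsqrt2_prime_def zsqrt2_associated_def)
  then show ?thesis by (auto simp: zsqrt2_norm_mult zsqrt2_unit_iff_norm abs_mult)
qed

text \<open>A rational prime q dividing the norm either divides both coordinates, and then z is
  associated to q, or makes 2 a square modulo q; then -q is a norm, and an element of that norm
  divides z.\<close>

lemma norm_of_zsqrt2_prime: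
  assumes z: "zsqrt2_prime z"
  shows "prime \<bar>zsqrt2_norm z\<bar> \<or> (\<exists>q::nat. \<bar>zsqrt2_norm z\<bar> = (int q)\<^sup>2)"
proof -
  obtain a b where ab: "z = ZSqrt2 a b" by (cases z)
  define k where "k = zsqrt2_norm z"
  have k: "k = a\<^sup>2 - 2 * b\<^sup>2" by (simp add: k_def ab zsqrt2_norm_def)
  have "\<bar>k\<bar> \<noteq> 1" using z by (auto simp: k_def zsqrt2_prime_def zsqrt2_unit_iff_norm abs_if split: if_splits)
  then have "nat \<bar>k\<bar> \<noteq> 1" by auto
  then obtain q where q: "prime q" "q dvd nat \<bar>k\<bar>" using prime_factor_nat by blast
  then have qk: "int q dvd k" by simp
  have pq: "prime (int q)" using q by simp
  have q1: "int q > 1" using prime_gt_1_nat[OF q(1)] by simp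
  show ?thesis
  proof (cases "int q dvd b")
    case True
    have "int q dvd (a\<^sup>2 - 2 * b\<^sup>2) + 2 * b\<^sup>2"
      using qk k True by (intro dvd_add) (auto simp: power2_eq_square)
    then have "int q dvd a\<^sup>2" by simp
    then have "int q dvd a" by (rule prime_dvd_power[OF pq])
    with True obtain c d where "a = int q * c" "b = int q * d" by (auto elim!: dvdE)
    then have "z = ZSqrt2 (int q) 0 * ZSqrt2 c d" by (simp add: ab times_zsqrt2_def)
    then have "ZSqrt2 (int q) 0 dvd z" by simp
    moreover have "\<bar>zsqrt2_norm (ZSqrt2 (int q) 0)\<bar> = (int q)\<^sup>2" by (simp add: zsqrt2_norm_def)
    moreover have "(int q)\<^sup>2 \<noteq> 1" using q1 by (simp add: power2_eq_1_iff)
    ultimately have "\<bar>zsqrt2_norm z\<bar> = (int q)\<^sup>2" using norm_eq_if_nonunit_dvd_prime[OF z] by metis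
    then show ?thesis by blast
  next
    case False
    then have "coprime b (int q)" using prime_imp_coprime[OF pq] by (simp add: coprime_commute)
    then obtain c where c: "[b * c = 1] (mod int q)" using cong_solve_coprime_int by blast
    \<comment> \<open>As c inverts b modulo q, a c stands for a/b, a square root of 2 because q
      divides a^2 - 2 b^2.\<close>
    have "(a * c)\<^sup>2 - 2 = (a\<^sup>2 - 2 * b\<^sup>2) * c\<^sup>2 + 2 * (b * c + 1) * (b * c - 1)"
      by (simp add: power2_eq_square algebra_simps)
    also have "int q dvd \<dots>"
      using qk k c by (intro dvd_add dvd_mult dvd_mult2) (auto simp: cong_iff_dvd_diff)
    finally have "[(a * c)\<^sup>2 = 2] (mod int q)" by (simp add: cong_iff_dvd_diff)
    then obtain r where r: "zsqrt2_norm r = - int q" using norm_minus_prime[OF q(1)] by blast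
    \<comment> \<open>Either \<open>r\<close> or its conjugate divides \<open>z\<close>; this replaces unique factorization.\<close>
    obtain u v0 where uv0: "r = ZSqrt2 u v0" by (cases r)
    have N0: "u\<^sup>2 - 2 * v0\<^sup>2 = - int q" using r by (simp add: uv0 zsqrt2_norm_def)
    have "(a * v0 - b * u) * (a * v0 + b * u) = v0\<^sup>2 * (a\<^sup>2 - 2 * b\<^sup>2) - b\<^sup>2 * (u\<^sup>2 - 2 * v0\<^sup>2)"
      by (simp add: power2_eq_square algebra_simps)
    also have "int q dvd \<dots>"
      unfolding N0 k[symmetric] using qk by (intro dvd_diff dvd_mult) auto
    finally have "int q dvd a * v0 - b * u \<or> int q dvd a * v0 + b * u"
      using pq by (simp add: prime_dvd_mult_iff)
    moreover have "a * v0 + b * u = - (a * (- v0) - b * u)" by simp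
    ultimately obtain v where v: "v = v0 \<or> v = - v0" "int q dvd a * v - b * u"
      by (metis dvd_minus_iff)
    have N: "u\<^sup>2 - 2 * v\<^sup>2 = - int q" using N0 v by auto
    \<comment> \<open>Up to sign, these are the coordinates of z times the conjugate of u + v
      \<surd>2, and q divides the first because it divides the second and the norm. Since u + v
      \<surd>2 times its conjugate is -q, division by q yields the cofactor -s + t \<surd>2 of
      z.\<close>
    have "(a * u - 2 * b * v)\<^sup>2 = 2 * (a * v - b * u)\<^sup>2 + (a\<^sup>2 - 2 * b\<^sup>2) * (u\<^sup>2 - 2 * v\<^sup>2)"
      by (simp add: power2_eq_square algebra_simps)
    also have "int q dvd \<dots>"
      unfolding N using v by (intro dvd_add dvd_mult) (auto simp: power2_eq_square)
    finally have "int q dvd a * u - 2 * b * v" by (rule prime_dvd_power[OF pq])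
    with v obtain s t where st: "a * u - 2 * b * v = int q * s" "a * v - b * u = int q * t"
      by (auto elim!: dvdE)
    define w where "w = ZSqrt2 u v"
    have nw: "zsqrt2_norm w = - int q" using N by (simp add: w_def zsqrt2_norm_def)
    have "int q * (- (u * s) + 2 * (v * t)) = - (u * (a * u - 2 * b * v)) + 2 * (v * (a * v - b * u))"
      unfolding st by (simp add: algebra_simps)
    also have "\<dots> = - a * (u\<^sup>2 - 2 * v\<^sup>2)" by (simp add: power2_eq_square algebra_simps)
    also have "\<dots> = int q * a" unfolding N by simp
    finally have e1: "a = - (u * s) + 2 * (v * t)" using q1 by simp
    have "int q * (u * t - v * s) = u * (a * v - b * u) - v * (a * u - 2 * b * v)"
      unfolding st by (simp add: algebra_simps)
    also have "\<dots> = - b * (u\<^sup>2 - 2 * v\<^sup>2)" by (simp add: power2_eq_square algebra_simps)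
    also have "\<dots> = int q * b" unfolding N by simp
    finally have e2: "b = u * t - v * s" using q1 by simp
    have "z = w * ZSqrt2 (- s) t"
      by (simp add: ab w_def times_zsqrt2_def e1 e2)
    then have "w dvd z" by simp
    moreover have "\<bar>zsqrt2_norm w\<bar> \<noteq> 1" using nw q1 by simp
    ultimately have "\<bar>zsqrt2_norm z\<bar> = int q" using norm_eq_if_nonunit_dvd_prime[OF z] nw by fastforce
    then show ?thesis using pq by simp
  qed
qed

text \<open>An odd square is 1 modulo 8, and 2 b^2 is 0 or 2 there. This keeps inert primes out of
  the norms.\<close>

lemma odd_norm_mod_8:
  fixes a b :: int
  assumes "odd (a\<^sup>2 - 2 * b\<^sup>2)"
  shows "(a\<^sup>2 - 2 * b\<^sup>2) mod 8 = 1 \<or> (a\<^sup>2 - 2 * b\<^sup>2) mod 8 = 7"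
proof -
  have "odd a" using assms by simp
  then obtain c where c: "a = 2 * c + 1" by (elim oddE)
  have "even (c * (c + 1))" by simp
  then obtain d where "c * (c + 1) = 2 * d" by (elim evenE)
  then have a2: "a\<^sup>2 = 8 * d + 1" by (simp add: c power2_eq_square algebra_simps)
  show ?thesis
  proof (cases "even b")
    case True
    then obtain e where "b = 2 * e" by (elim evenE)
    then have "a\<^sup>2 - 2 * b\<^sup>2 = 8 * (d - e\<^sup>2) + 1" unfolding a2 by (simp add: power2_eq_square)
    then obtain y where "a\<^sup>2 - 2 * b\<^sup>2 = 8 * y + 1" by blast
    then show ?thesis by simp
  next
    case False
    then obtain e where e: "b = 2 * e + 1" by (elim oddE)
    have "a\<^sup>2 - 2 * b\<^sup>2 = 8 * (d - e\<^sup>2 - e - 1) + 7" unfolding a2 e by (simp add: power2_eq_square algebra_simps)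
    then obtain y where "a\<^sup>2 - 2 * b\<^sup>2 = 8 * y + 7" by blast
    then show ?thesis by simp
  qed
qed

section \<open>Counting the families\<close>

definition split_primes :: "real \<Rightarrow> nat set" where
  "split_primes x = {p. prime p \<and> chi8 p = 1 \<and> real p \<le> x}"

lemma finite_split_primes: "finite (split_primes x)"
  by (rule finite_subset[of _ "{..nat \<lfloor>x\<rfloor>}"]) (auto simp: split_primes_def intro: le_nat_floor)

definition prime_norms :: "real \<Rightarrow> int set" where
  "prime_norms r = {k. \<bar>of_int k\<bar> \<le> r\<^sup>2 \<and> (\<exists>p \<in> zsqrt2_family k. zsqrt2_prime p)}"

lemma split_primes_subset_prime_norms:
  "int ` split_primes (r\<^sup>2) \<union> (\<lambda>p. - int p) ` split_primes (r\<^sup>2) \<subseteq> prime_norms r"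
proof -
  have "int p \<in> prime_norms r \<and> - int p \<in> prime_norms r" if p: "p \<in> split_primes (r\<^sup>2)" for p
  proof -
    have p': "prime p" "p mod 8 = 1 \<or> p mod 8 = 7" "real p \<le> r\<^sup>2"
      using p by (auto simp: split_primes_def chi8_def split: if_splits)
    obtain x :: int where "[x\<^sup>2 = 2] (mod int p)" using two_quadratic_residue[OF p'(1,2)] .
    then obtain z where z: "zsqrt2_norm z = - int p" using norm_minus_prime[OF p'(1)] by blast
    then obtain z' where z': "zsqrt2_norm z' = int p" using norm_uminus_exists[of "int p"] by auto
    have "zsqrt2_prime z" "zsqrt2_prime z'"
      using z z' p' by (auto intro!: zsqrt2_prime_if_norm_prime)
    then show ?thesis using z z' p'(3)
      by (auto simp: prime_norms_def zsqrt2_family_def zsqrt2_norm_def)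
  qed
  then show ?thesis by auto
qed

text \<open>It is left open which squares really are norms of primes: there are O(r) of them,
  negligible against r^2 / ln r. The values \<plusminus>2 stand apart because
  \<open>chi8 2 = 0\<close>.\<close>

lemma prime_norms_subset:
  "prime_norms r \<subseteq> int ` split_primes (r\<^sup>2) \<union> (\<lambda>p. - int p) ` split_primes (r\<^sup>2) \<union> {2, -2}
     \<union> ((\<lambda>q. (int q)\<^sup>2) ` {..nat \<lfloor>\<bar>r\<bar>\<rfloor>} \<union> (\<lambda>q. - (int q)\<^sup>2) ` {..nat \<lfloor>\<bar>r\<bar>\<rfloor>})"
proof
  fix k assume "k \<in> prime_norms r"
  then obtain z where k: "\<bar>real_of_int k\<bar> \<le> r\<^sup>2" and z: "zsqrt2_norm z = k" "zsqrt2_prime z"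
    by (auto simp: prime_norms_def zsqrt2_family_def zsqrt2_norm_def)
  from norm_of_zsqrt2_prime[OF z(2)]
  show "k \<in> int ` split_primes (r\<^sup>2) \<union> (\<lambda>p. - int p) ` split_primes (r\<^sup>2) \<union> {2, -2}
     \<union> ((\<lambda>q. (int q)\<^sup>2) ` {..nat \<lfloor>\<bar>r\<bar>\<rfloor>} \<union> (\<lambda>q. - (int q)\<^sup>2) ` {..nat \<lfloor>\<bar>r\<bar>\<rfloor>})"
  proof
    assume "prime \<bar>zsqrt2_norm z\<bar>"
    then have pk: "prime \<bar>k\<bar>" by (simp add: z)
    define p where "p = nat \<bar>k\<bar>"
    have p: "prime p" "int p = \<bar>k\<bar>" using pk by (auto simp: p_def prime_nat_iff_prime)
    show ?thesis
    proof (cases "p = 2")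
      case True
      then show ?thesis using p by auto
    next
      case False
      then have "odd p" using p prime_odd_nat prime_ge_2_nat by (metis le_neq_implies_less)
      then have "odd k" using p(2) by presburger
      moreover have "k = (rat_part z)\<^sup>2 - 2 * (sqrt_part z)\<^sup>2" using z by (simp add: zsqrt2_norm_def)
      ultimately have "k mod 8 = 1 \<or> k mod 8 = 7" using odd_norm_mod_8 by metis
      then have "\<bar>k\<bar> mod 8 = 1 \<or> \<bar>k\<bar> mod 8 = 7" by (auto simp: abs_if zmod_zminus1_eq_if)
      then have "p mod 8 = 1 \<or> p mod 8 = 7" using zmod_int[of p 8] p(2) by auto
      then have "chi8 p = 1" by (auto simp: chi8_def)
      moreover have "real p \<le> r\<^sup>2" using k p(2) by (metis of_int_abs of_int_of_nat_eq)
      ultimately have "p \<in> split_primes (r\<^sup>2)" using p by (simp add: split_primes_def)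
      moreover have "k = int p \<or> k = - int p" using p by auto
      ultimately show ?thesis by auto
    qed
  next
    assume "\<exists>q::nat. \<bar>zsqrt2_norm z\<bar> = (int q)\<^sup>2"
    then obtain q :: nat where q: "\<bar>k\<bar> = (int q)\<^sup>2" using z by auto
    then have "(real q)\<^sup>2 \<le> \<bar>r\<bar>\<^sup>2" using k by (metis of_int_abs of_int_of_nat_eq of_int_power power2_abs)
    then have "real q \<le> \<bar>r\<bar>" by (rule power2_le_imp_le) auto
    then have "q \<le> nat \<lfloor>\<bar>r\<bar>\<rfloor>" by (simp add: le_nat_floor)
    moreover have "k = (int q)\<^sup>2 \<or> k = - (int q)\<^sup>2" using q by auto
    ultimately show ?thesis by auto
  qed
qed

lemma num_prime_families_bounds:
  "2 * card (split_primes (r\<^sup>2)) \<le> num_prime_families r"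
  "real (num_prime_families r) \<le> 2 * real (card (split_primes (r\<^sup>2))) + 2 * \<bar>r\<bar> + 4"
proof -
  define P where "P = split_primes (r\<^sup>2)"
  define Q where "Q = {..nat \<lfloor>\<bar>r\<bar>\<rfloor>}"
  have F: "num_prime_families r = card (prime_norms r)"
    by (simp add: num_prime_families_def prime_norms_def)
  have finP: "finite P" and finQ: "finite Q" by (simp_all add: P_def Q_def finite_split_primes)
  have fin: "finite (prime_norms r)"
    by (rule finite_subset[OF prime_norms_subset]) (simp add: finite_split_primes)
  have inj: "inj_on int P" "inj_on (\<lambda>p. - int p) P" by (auto simp: inj_on_def)
  have "0 \<notin> P" by (auto simp: P_def split_primes_def)
  then have "int ` P \<inter> (\<lambda>p. - int p) ` P = {}"
  proof -
    have "int x \<noteq> - int y" if "x \<in> P" for x y using that \<open>0 \<notin> P\<close> by (cases "x = 0") auto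
    then show ?thesis by blast
  qed
  then have "card (int ` P \<union> (\<lambda>p. - int p) ` P) = 2 * card P"
    using finP inj by (simp add: card_Un_disjoint card_image)
  then show "2 * card (split_primes (r\<^sup>2)) \<le> num_prime_families r"
    using card_mono[OF fin split_primes_subset_prime_norms[of r]] by (simp add: F P_def)
  have "num_prime_families r \<le> card (int ` P \<union> (\<lambda>p. - int p) ` P \<union> {2, -2}
     \<union> ((\<lambda>q. (int q)\<^sup>2) ` Q \<union> (\<lambda>q. - (int q)\<^sup>2) ` Q))"
    unfolding F P_def Q_def using prime_norms_subset[of r]
    by (intro card_mono) (simp_all add: finite_split_primes)
  also have "\<dots> \<le> (card (int ` P) + card ((\<lambda>p. - int p) ` P) + card {2, - 2 :: int})
     + (card ((\<lambda>q. (int q)\<^sup>2) ` Q) + card ((\<lambda>q. - (int q)\<^sup>2) ` Q))"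
    by (intro order_trans[OF card_Un_le] add_mono order_refl)
  also have "\<dots> \<le> (card P + card P + 2) + (card Q + card Q)"
    by (intro add_mono card_image_le finP finQ) auto
  finally have "real (num_prime_families r) \<le> 2 * real (card P) + 2 + 2 * real (card Q)"
    by linarith
  moreover have "real (card Q) \<le> \<bar>r\<bar> + 1" by (simp add: Q_def)
  ultimately show "real (num_prime_families r) \<le> 2 * real (card (split_primes (r\<^sup>2))) + 2 * \<bar>r\<bar> + 4"
    by (simp add: P_def)
qed

lemma num_families_eq: "num_families r = 2 * num_represented (nat \<lfloor>r\<^sup>2\<rfloor>)"
proof -
  define S where "S = {m :: nat. 0 < m \<and> m \<le> nat \<lfloor>r\<^sup>2\<rfloor> \<and> (\<exists>x y :: int. int m = x\<^sup>2 - 2 * y\<^sup>2)}"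
  have rep: "(\<exists>a b :: int. k = a\<^sup>2 - 2 * b\<^sup>2) \<longleftrightarrow> (\<exists>z. zsqrt2_norm z = k)" for k
    unfolding zsqrt2_norm_def by (metis zsqrt2.sel)
  have le: "\<bar>real_of_int k\<bar> \<le> r\<^sup>2 \<longleftrightarrow> nat \<bar>k\<bar> \<le> nat \<lfloor>r\<^sup>2\<rfloor>" for k
    by (simp add: nat_le_iff le_floor_iff)
  have "{k :: int. k \<noteq> 0 \<and> \<bar>of_int k\<bar> \<le> r\<^sup>2 \<and> (\<exists>a b :: int. k = a\<^sup>2 - 2 * b\<^sup>2)} = int ` S \<union> (\<lambda>m. - int m) ` S"
    (is "?L = ?R")
  proof
    show "?L \<subseteq> ?R"
    proof
      fix k assume "k \<in> ?L"
      then have k: "k \<noteq> 0" "nat \<bar>k\<bar> \<le> nat \<lfloor>r\<^sup>2\<rfloor>" "\<exists>z. zsqrt2_norm z = k" using le[of k] rep[of k] by auto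
      then have "\<exists>z. zsqrt2_norm z = \<bar>k\<bar>" using norm_uminus_exists[of k] by (auto simp: abs_if)
      then have "nat \<bar>k\<bar> \<in> S" using k by (auto simp: S_def rep)
      moreover have "k = int (nat \<bar>k\<bar>) \<or> k = - int (nat \<bar>k\<bar>)" by auto
      ultimately show "k \<in> ?R" by blast
    qed
    show "?R \<subseteq> ?L"
    proof
      fix k assume "k \<in> ?R"
      then obtain m where m: "m \<in> S" "k = int m \<or> k = - int m" by auto
      then have "\<exists>z. zsqrt2_norm z = int m" by (simp add: S_def rep)
      then have "\<exists>z. zsqrt2_norm z = k" using m(2) norm_uminus_exists[of "int m"] by auto
      moreover have "nat \<bar>k\<bar> = m" "m > 0" "m \<le> nat \<lfloor>r\<^sup>2\<rfloor>" using m by (auto simp: S_def)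
      ultimately show "k \<in> ?L" using le[of k] rep[of k] by auto
    qed
  qed
  moreover have "int ` S \<inter> (\<lambda>m. - int m) ` S = {}" by (auto simp: S_def)
  moreover have "finite S" by (auto simp: S_def)
  moreover have "inj_on int S" "inj_on (\<lambda>p. - int p) S" by (auto simp: inj_on_def)
  ultimately have "num_families r = card S + card S"
    unfolding num_families_def by (simp add: card_Un_disjoint card_image)
  then show ?thesis by (simp add: num_represented_def S_def)
qed

section \<open>Asymptotics\<close>

lemma psiK_mono: "m \<le> n \<Longrightarrow> psiK m \<le> psiK n"
  unfolding psiK_def by (intro sum_mono2) (auto simp: chi8_def mangoldt_nonneg)

lemma psiK_le: "psiK n \<le> 8 * real n"
proof -
  have "psiK n \<le> (\<Sum>k\<le>n. mangoldt k * 2)"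
    unfolding psiK_def by (intro sum_mono mult_left_mono) (auto simp: chi8_def mangoldt_nonneg)
  also have "\<dots> = 2 * psi n" by (simp add: psi_def sum_distrib_left mult.commute)
  finally show ?thesis using psi_le[of n] by linarith
qed

lemma psiK_asymptotics: "(\<lambda>n. psiK n / real n) \<longlonglongrightarrow> 1"
  by (rule tendsto_if_summable_deviation[OF psiK_mono summable_psiK[OF psiK_le]])

text \<open>Prime powers are sorted by weight: at most 2 ln n at split primes, nothing at inert
  primes since 1 + \<chi> = 0, ln 2 at the prime 2, and the proper powers are few.\<close>

lemma psiK_le_split_primes:
  assumes n: "n \<ge> 2"
  shows "psiK n \<le> 2 * real (card (split_primes n)) * ln n + ln 2 + 2 * ln n * ((sqrt n + 1) * (log 2 n + 1))"
proof -
  define S where "S = split_primes n"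
  define T where "T = {k. k \<le> n \<and> primepow k \<and> \<not> prime k}"
  have "psiK n \<le> (\<Sum>k\<le>n. (if k \<in> S then 2 * ln n else 0) + (if k \<in> {2} then ln 2 else 0) + (if k \<in> T then 2 * ln n else 0))"
    unfolding psiK_def
  proof (rule sum_mono)
    fix k assume k: "k \<in> {..n}"
    have ln0: "ln (real n) \<ge> 0" using n by simp
    have nonneg: "(if k \<in> S then 2 * ln n else 0) \<ge> 0" "(if k \<in> {2} then ln 2 else 0) \<ge> (0::real)"
      "(if k \<in> T then 2 * ln n else 0) \<ge> 0"
      using ln0 by auto
    show "mangoldt k * (1 + real_of_int (chi8 k)) \<le>
      (if k \<in> S then 2 * ln n else 0) + (if k \<in> {2} then ln 2 else 0) + (if k \<in> T then 2 * ln n else 0)"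
    proof (cases "primepow k")
      case False
      then show ?thesis using ln0 by (simp add: mangoldt_def)
    next
      case True
      then have k0: "k > 0" by (auto intro: Nat.gr0I)
      have lk: "mangoldt k \<le> ln (real n)"
        using mangoldt_le[OF k0] k k0 by (meson atMost_iff ln_mono of_nat_0_less_iff of_nat_mono order_trans)
      have m2: "mangoldt k * (1 + real_of_int (chi8 k)) \<le> ln (real n) * 2"
        using lk ln0 by (intro mult_mono) (auto simp: chi8_def mangoldt_nonneg)
      show ?thesis
      proof (cases "prime k")
        case False
        then have "(if k \<in> T then 2 * ln n else 0) = 2 * ln n" using True k by (simp add: T_def)
        then show ?thesis using m2 nonneg by linarith
      next
        case prime: True
        consider "chi8 k = 1" | "chi8 k = - 1" | "chi8 k = 0"
          unfolding chi8_def by presburger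
        then show ?thesis
        proof cases
          case 1
          then have "(if k \<in> S then 2 * ln n else 0) = 2 * ln n" using prime k by (simp add: S_def split_primes_def)
          then show ?thesis using m2 nonneg by linarith
        next
          case 2
          then show ?thesis using ln0 by auto
        next
          case 3
          have "k = 2"
          proof (rule ccontr)
            assume "k \<noteq> 2"
            then have "odd k" using prime prime_odd_nat prime_ge_2_nat by (metis le_neq_implies_less)
            then have "odd (k mod 8)" by presburger
            then show False using 3 by (cases k rule: mod_8_cases) (auto simp: chi8_def)
          qed
          then show ?thesis using 3 ln0 mangoldt_prime[OF prime, where 'a = real] by auto
        qed
      qed
    qed
  qed
  also have "\<dots> = real (card S) * (2 * ln n) + ln 2 + real (card T) * (2 * ln n)"
  proof -
    have "{..n} \<inter> S = S" "{..n} \<inter> T = T" by (auto simp: S_def T_def split_primes_def)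
    moreover have "{..n} \<inter> {2} = {2}" using n by auto
    ultimately show ?thesis by (simp only: sum.distrib sum.If_cases finite_atMost Collect_mem_eq sum_constant) simp
  qed
  also have "\<dots> \<le> real (card S) * (2 * ln n) + ln 2 + ((sqrt n + 1) * (log 2 n + 1)) * (2 * ln n)"
    unfolding T_def using n by (intro add_left_mono mult_right_mono card_proper_prime_powers_le) auto
  finally show ?thesis by (simp add: S_def algebra_simps)
qed

text \<open>Only split primes above the threshold y are kept, each of weight at least 2 ln y; at
  most y are lost.\<close>

lemma split_primes_le_psiK:
  assumes y: "y > 1"
  shows "2 * ln y * (real (card (split_primes n)) - y) \<le> psiK n"
proof -
  define S where "S = split_primes n"
  define T where "T = {p \<in> S. real p > y}"
  have fin: "finite S" by (simp add: S_def finite_split_primes)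
  have "card (S - T) \<le> card {1..nat \<lfloor>y\<rfloor>}"
    by (intro card_mono) (auto simp: S_def T_def split_primes_def Suc_le_eq prime_gt_0_nat not_less intro!: le_nat_floor)
  then have "real (card (S - T)) \<le> y" using y by (simp add: le_nat_iff le_floor_iff)
  moreover have "card S = card T + card (S - T)"
    using fin by (metis T_def card_Diff_subset card_mono finite_Collect_conjI le_add_diff_inverse mem_Collect_eq finite_subset subsetI)
  ultimately have "real (card S) - y \<le> real (card T)" by simp
  then have "2 * ln y * (real (card S) - y) \<le> 2 * ln y * real (card T)"
    using y by (intro mult_left_mono) auto
  also have "\<dots> = (\<Sum>k\<in>T. 2 * ln y)" by simp
  also have "\<dots> \<le> (\<Sum>k\<in>T. mangoldt k * (1 + real_of_int (chi8 k)))"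
  proof (rule sum_mono)
    fix k assume k: "k \<in> T"
    then have "mangoldt k * (1 + real_of_int (chi8 k)) = 2 * ln (real k)"
      by (simp add: T_def S_def split_primes_def)
    then show "2 * ln y \<le> mangoldt k * (1 + real_of_int (chi8 k))" using k y by (simp add: T_def)
  qed
  also have "\<dots> \<le> psiK n"
    unfolding psiK_def by (intro sum_mono2) (auto simp: T_def S_def split_primes_def chi8_def mangoldt_nonneg)
  finally show ?thesis by (simp add: S_def)
qed

theorem split_primes_asymptotics:
  "(\<lambda>n. real (card (split_primes n)) * ln n / n) \<longlonglongrightarrow> 1 / 2"
proof (rule tendsto_sandwich)
  let ?l = "\<lambda>n::nat. psiK n / n / 2 - ln 2 / (2 * real n) - ln n * ((sqrt n + 1) * (log 2 n + 1)) / n"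
  let ?u = "\<lambda>n::nat. ln n * (n / (ln n)\<^sup>2) / n + psiK n / n * (ln n / (2 * ln (n / (ln n)\<^sup>2)))"
  show "\<forall>\<^sub>F n in sequentially. ?l n \<le> real (card (split_primes n)) * ln n / n"
    using eventually_ge_at_top[of 2]
  proof eventually_elim
    case (elim n)
    have "?l n = (psiK n - ln 2 - 2 * ln n * ((sqrt n + 1) * (log 2 n + 1))) / (2 * n)"
      using elim by (simp add: field_simps)
    also have "\<dots> \<le> (2 * real (card (split_primes n)) * ln n) / (2 * n)"
      using psiK_le_split_primes[OF elim] by (intro divide_right_mono) auto
    finally show ?case by simp
  qed
  have "\<forall>\<^sub>F n::nat in sequentially. real n / (ln n)\<^sup>2 > 1" by real_asymp
  then show "\<forall>\<^sub>F n in sequentially. real (card (split_primes n)) * ln n / n \<le> ?u n"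
    using eventually_ge_at_top[of 2]
  proof eventually_elim
    case (elim n)
    \<comment> \<open>Small enough that the primes below \<open>y\<close> are negligible, yet \<open>ln y ~ ln n\<close>.\<close>
    define y where "y = real n / (ln n)\<^sup>2"
    have y: "ln y > 0" using elim by (simp add: y_def)
    have "2 * ln y * (real (card (split_primes n)) - y) \<le> psiK n"
      using elim by (intro split_primes_le_psiK) (simp add: y_def)
    then have "real (card (split_primes n)) \<le> y + psiK n / (2 * ln y)"
      using y by (simp add: field_simps)
    then have "real (card (split_primes n)) * (ln n / n) \<le> (y + psiK n / (2 * ln y)) * (ln n / n)"
      using elim by (intro mult_right_mono) auto
    also have "\<dots> = ln n * y / n + psiK n / n * (ln n / (2 * ln y))"
      by (simp add: algebra_simps)
    finally show ?case by (simp add: y_def)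
  qed
  have "?l \<longlonglongrightarrow> 1 / 2 - 0 - 0"
  proof (intro tendsto_diff tendsto_divide psiK_asymptotics tendsto_const)
    show "(\<lambda>n::nat. ln 2 / (2 * real n)) \<longlonglongrightarrow> 0" by real_asymp
    show "(\<lambda>n::nat. ln n * ((sqrt n + 1) * (log 2 n + 1)) / n) \<longlonglongrightarrow> 0"
      unfolding log_def by real_asymp
  qed simp
  then show "?l \<longlonglongrightarrow> 1 / 2" by simp
  have "?u \<longlonglongrightarrow> 0 + 1 * (1 / 2)"
  proof (intro tendsto_add tendsto_mult psiK_asymptotics)
    show "(\<lambda>n::nat. ln n * (n / (ln n)\<^sup>2) / n) \<longlonglongrightarrow> 0" by real_asymp
    show "(\<lambda>n::nat. ln n / (2 * ln (n / (ln n)\<^sup>2))) \<longlonglongrightarrow> 1 / 2" by real_asymp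
  qed
  then show "?u \<longlonglongrightarrow> 1 / 2" by simp
qed

text \<open>With N the integer part of r^2, F is asymptotic to N / ln N and G to 2 b N / \<surd>(ln
  N). The ratio is 1 / (2 b \<surd>(ln N)), and ln N ~ 2 ln r puts the 2 under the root.\<close>

theorem theorem2p13:
  fixes b :: real
  assumes "b > 0"
    and "(\<lambda>n. real (num_represented n)) \<sim>[at_top] (\<lambda>n. b * real n / sqrt (ln (real n)))"
  shows "(\<lambda>r::real. real (num_prime_families r) / real (num_families r))
           \<sim>[at_top] (\<lambda>r. 1 / (2 * b * sqrt (2 * ln r)))"
proof (rule asymp_equivI')
  define N :: "real \<Rightarrow> nat" where "N r = nat \<lfloor>r\<^sup>2\<rfloor>" for r
  have N_bounds: "real (N r) \<le> r\<^sup>2" "r\<^sup>2 - 1 \<le> real (N r)" for r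
    unfolding N_def using zero_le_power2[of r] by linarith+
  have N_lim: "filterlim N at_top at_top"
  proof -
    have "filterlim (\<lambda>r::real. r\<^sup>2 - 1) at_top at_top" by real_asymp
    then have "filterlim (\<lambda>r. real (N r)) at_top at_top"
      by (rule filterlim_at_top_mono) (use N_bounds in auto)
    then have "\<forall>\<^sub>F r in at_top. real (N r) \<ge> real m" for m
      unfolding filterlim_at_top by blast
    then show ?thesis by (simp add: filterlim_at_top)
  qed
  have N2: "\<forall>\<^sub>F r in at_top. N r \<ge> 2 \<and> r \<ge> 2"
    using filterlim_at_top[THEN iffD1, OF N_lim, rule_format, of 2] eventually_ge_at_top[of 2]
    by eventually_elim auto
  have split_N: "split_primes (r\<^sup>2) = split_primes (real (N r))" for r
  proof -
    have "real p \<le> r\<^sup>2 \<longleftrightarrow> real p \<le> real (N r)" for p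
      using N_bounds(1)[of r] le_nat_floor[of p "r\<^sup>2"] unfolding N_def[symmetric]
      by (metis of_nat_le_iff order_trans)
    then show ?thesis by (simp add: split_primes_def)
  qed
  define P where "P r = real (card (split_primes (r\<^sup>2)))" for r
  have P: "((\<lambda>r. P r * ln (N r) / N r) \<longlongrightarrow> 1 / 2) at_top"
    unfolding P_def split_N using filterlim_compose[OF split_primes_asymptotics N_lim] .
  have F: "((\<lambda>r. real (num_prime_families r) * ln (N r) / N r) \<longlongrightarrow> 1) at_top"
  proof (rule tendsto_sandwich)
    show "\<forall>\<^sub>F r in at_top. 2 * (P r * ln (N r) / N r) \<le> real (num_prime_families r) * ln (N r) / N r"
      using N2
    proof eventually_elim
      case (elim r)
      have "2 * P r \<le> real (num_prime_families r)"
        using num_prime_families_bounds(1)[of r] unfolding P_def by linarith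
      then have "2 * P r * (ln (N r) / N r) \<le> real (num_prime_families r) * (ln (N r) / N r)"
        using elim by (intro mult_right_mono) auto
      then show ?case by simp
    qed
    show "\<forall>\<^sub>F r in at_top. real (num_prime_families r) * ln (N r) / N r
            \<le> 2 * (P r * ln (N r) / N r) + (2 * r + 4) * ln (r\<^sup>2) / (r\<^sup>2 - 1)"
      using N2
    proof eventually_elim
      case (elim r)
      have r2: "r\<^sup>2 > 1" using elim by (simp add: power2_eq_square less_1_mult)
      have "real (num_prime_families r) \<le> 2 * P r + (2 * r + 4)"
        using num_prime_families_bounds(2)[of r] elim unfolding P_def by simp
      then have "real (num_prime_families r) * (ln (N r) / N r) \<le> (2 * P r + (2 * r + 4)) * (ln (N r) / N r)"
        using elim by (intro mult_right_mono) auto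
      also have "\<dots> = 2 * (P r * ln (N r) / N r) + (2 * r + 4) * ln (N r) / N r"
        by (simp add: algebra_simps add_divide_distrib)
      \<comment> \<open>Bounding N by r^2 above and r^2 - 1 below turns the error into an elementary
        function of r, which \<open>real_asymp\<close> can handle.\<close>
      also have "(2 * r + 4) * ln (N r) / N r \<le> (2 * r + 4) * ln (r\<^sup>2) / (r\<^sup>2 - 1)"
        using N_bounds[of r] elim r2 by (intro frac_le mult_left_mono ln_mono) auto
      finally show ?case by simp
    qed
    show "((\<lambda>r. 2 * (P r * ln (N r) / N r)) \<longlongrightarrow> 1) at_top"
      using tendsto_mult_left[OF P, of 2] by simp
    have "((\<lambda>r::real. (2 * r + 4) * ln (r\<^sup>2) / (r\<^sup>2 - 1)) \<longlongrightarrow> 0) at_top" by real_asymp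
    from tendsto_add[OF tendsto_mult_left[OF P, of 2] this]
    show "((\<lambda>r. 2 * (P r * ln (N r) / N r) + (2 * r + 4) * ln (r\<^sup>2) / (r\<^sup>2 - 1)) \<longlongrightarrow> 1) at_top"
      by simp
  qed
  have G: "((\<lambda>r. b * real (N r) / sqrt (ln (N r)) / real (num_represented (N r))) \<longlongrightarrow> 1) at_top"
  proof -
    have "\<forall>\<^sub>F n::nat in sequentially. b * real n / sqrt (ln n) \<noteq> 0"
      using eventually_ge_at_top[of 2] by eventually_elim (use \<open>b > 0\<close> in auto)
    then have "((\<lambda>n. b * real n / sqrt (ln n) / real (num_represented n)) \<longlongrightarrow> 1) at_top"
      by (intro asymp_equivD_strong[OF asymp_equiv_symI[OF assms(2)]]) (auto elim: eventually_mono)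
    then show ?thesis by (rule filterlim_compose[OF _ N_lim])
  qed
  have "((\<lambda>r. 2 * ln r / ln (N r)) \<longlongrightarrow> 1) at_top"
  proof (rule tendsto_sandwich)
    show "\<forall>\<^sub>F r in at_top. 2 * ln r / ln (r\<^sup>2) \<le> 2 * ln r / ln (N r)"
      using N2 by eventually_elim (use N_bounds in \<open>auto intro!: divide_left_mono\<close>)
    show "\<forall>\<^sub>F r in at_top. 2 * ln r / ln (N r) \<le> 2 * ln r / ln (r\<^sup>2 - 1)"
      using N2
    proof eventually_elim
      case (elim r)
      have "r\<^sup>2 \<ge> 2\<^sup>2" using elim by (intro power_mono) auto
      then show ?case using N_bounds[of r] elim by (intro divide_left_mono mult_pos_pos) auto
    qed
  qed real_asymp+
  then have S: "((\<lambda>r. sqrt (2 * ln r / ln (N r))) \<longlongrightarrow> sqrt 1) at_top"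
    by (rule tendsto_real_sqrt)
  \<comment> \<open>The factors are chosen so that N and ln N cancel, leaving b \<surd>(2 ln r)
    times F over \<open>num_represented\<close>; this is the required quotient because G is twice
    that count.\<close>
  have "((\<lambda>r. real (num_prime_families r) * ln (N r) / N r
      * (b * real (N r) / sqrt (ln (N r)) / real (num_represented (N r)))
      * sqrt (2 * ln r / ln (N r))) \<longlongrightarrow> 1 * 1 * sqrt 1) at_top"
    by (intro tendsto_mult F G S)
  note lim = this[unfolded real_sqrt_one mult_1_right]
  show "((\<lambda>r. real (num_prime_families r) / real (num_families r) / (1 / (2 * b * sqrt (2 * ln r)))) \<longlongrightarrow> 1) at_top"
  proof (rule Lim_transform_eventually[OF lim])
    show "\<forall>\<^sub>F r in at_top. real (num_prime_families r) * ln (N r) / N r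
      * (b * real (N r) / sqrt (ln (N r)) / real (num_represented (N r)))
      * sqrt (2 * ln r / ln (N r))
      = real (num_prime_families r) / real (num_families r) / (1 / (2 * b * sqrt (2 * ln r)))"
      using N2
    proof eventually_elim
      case (elim r)
      define q where "q = sqrt (ln (real (N r)))"
      have q: "q > 0" "ln (real (N r)) = q * q" using elim by (simp_all add: q_def)
      have "real (num_families r) = 2 * real (num_represented (N r))"
        by (simp add: num_families_eq N_def)
      then show ?case
        using elim q(1) unfolding real_sqrt_divide q_def[symmetric] q(2)
        by (cases "num_represented (N r) = 0") (simp_all add: field_simps)
    qed
  qed
qed

end
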